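(* Let $X,Y$ be complex Banach spaces. The correspondence $f\mapsto f^t$ is an isometric isomorphism from $\mathcal{H}L_0^{\mathcal{K}}(B_X,Y)$, with the norm $L(\cdot)$, onto $\mathcal{L}((Y^*,bw^* );\mathcal{H}L_0(B_X))$, the space of all bounded-weak*-to-norm continuous linear operators from $Y^*$ into $\mathcal{H}L_0(B_X)$, with the operator norm.
   Context: $B_X$ is the open unit ball of $X$. $\mathcal{H}L_0(B_X,Y)$ is the Banach space of all holomorphic Lipschitz maps $f:B_X\to Y$ with $f(0)=0$, with norm $L(f)=\sup\{\|f(x)-f(y)\|/\|x-y\|: x,y\in B_X,\ x\ne y\}$; $\mathcal{H}L_0(B_X)=\mathcal{H}L_0(B_X,\mathbb{C})$. $\mathcal{H}L_0^{\mathcal{K}}(B_X,Y)$ is the set of compact holomorphic Lipschitz maps, i.e. those $f\in\mathcal{H}L_0(B_X,Y)$ for which $\mathrm{Im}_L(f)=\{(f(x)-f(y))/\|x-y\|:x,y\in B_X,\ x\neq y\}$ is relatively compact in $Y$. The transpose $f^t:Y^*\to\mathcal{H}L_0(B_X)$ is $f^t(y^* )=y^*\circ f$. The bounded weak* topology $bw^*$ on $Y^*$ is the finest topology agreeing with the weak* topology on every norm-bounded subset. *)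

theory Defs
  imports "HOL-Analysis.Analysis"
begin

section \<open>Complex Banach spaces\<close>

class complex_normed_vector = real_normed_vector +
  fixes scaleC :: "complex \<Rightarrow> 'a \<Rightarrow> 'a"  (infixr \<open>*\<^sub>C\<close> 75)
  assumes scaleC_add_right: "c *\<^sub>C (x + y) = c *\<^sub>C x + c *\<^sub>C y"
    and scaleC_add_left: "(c + d) *\<^sub>C x = c *\<^sub>C x + d *\<^sub>C x"
    and scaleC_scaleC: "c *\<^sub>C (d *\<^sub>C x) = (c * d) *\<^sub>C x"
    and scaleC_of_real: "complex_of_real r *\<^sub>C x = r *\<^sub>R x"
    and norm_scaleC: "norm (c *\<^sub>C x) = cmod c * norm x"

class complex_banach = complex_normed_vector + complete_space

subclass (in complex_banach) banach ..

instantiation complex :: complex_banach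
begin

definition scaleC_complex :: "complex \<Rightarrow> complex \<Rightarrow> complex"
  where "scaleC_complex c z = c * z"

instance
  by standard (simp_all add: scaleC_complex_def algebra_simps norm_mult scaleR_conv_of_real)

end

lemma scaleC_one [simp]: "1 *\<^sub>C x = (x :: 'a::complex_normed_vector)"
  using scaleC_of_real[of 1 x] by simp

global_interpretation complex_vector:
  vector_space "scaleC :: complex \<Rightarrow> 'a \<Rightarrow> 'a::complex_normed_vector"
  by standard (simp_all add: scaleC_add_right scaleC_add_left scaleC_scaleC)

abbreviation clinear :: "('a::complex_normed_vector \<Rightarrow> 'b::complex_normed_vector) \<Rightarrow> bool"
  where "clinear \<equiv> Vector_Spaces.linear scaleC scaleC"

lemma clinear_iff:
  "clinear f \<longleftrightarrow> (\<forall>x y. f (x + y) = f x + f y) \<and> (\<forall>c x. f (c *\<^sub>C x) = c *\<^sub>C f x)"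
  by (simp add: Vector_Spaces.linear_iff complex_vector.vector_space_axioms)

lemma clinear_imp_linear: "clinear f \<Longrightarrow> linear f"
  by (auto simp: clinear_iff Real_Vector_Spaces.linear_iff simp flip: scaleC_of_real)

lemma bounded_linear_scaleC_right:
  "bounded_linear (\<lambda>x :: 'a::complex_normed_vector. c *\<^sub>C x)"
  by (rule bounded_linear_intro[where K = "cmod c"])
     (simp_all add: scaleC_add_right scaleC_scaleC norm_scaleC mult.commute flip: scaleC_of_real)

lemmas bounded_linear_compose_scaleC =
  bounded_linear_compose[OF bounded_linear_scaleC_right]

lemma onorm_scaleC:
  fixes f :: "'a::real_normed_vector \<Rightarrow> 'b::complex_normed_vector"
  assumes "bounded_linear f"
  shows "onorm (\<lambda>x. c *\<^sub>C f x) = cmod c * onorm f"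
proof -
  have "onorm (\<lambda>x. c *\<^sub>C f x) = onorm (\<lambda>x. cmod c *\<^sub>R f x)"
    by (simp add: onorm_def norm_scaleC)
  then show ?thesis
    using onorm_scaleR[OF assms, of "cmod c"] by simp
qed


section \<open>The dual space and its topologies\<close>

typedef (overloaded) 'a cdual =
  "{\<phi> :: 'a::complex_normed_vector \<Rightarrow> complex. clinear \<phi> \<and> bounded_linear \<phi>}"
  morphisms cdual_apply Abs_cdual
  by (rule exI[of _ "\<lambda>_. 0"]) (simp add: clinear_iff)

setup_lifting type_definition_cdual

instantiation cdual :: (complex_normed_vector) complex_normed_vector
begin

lift_definition zero_cdual :: "'a cdual" is "\<lambda>_. 0"
  by (simp add: clinear_iff)

lift_definition plus_cdual :: "'a cdual \<Rightarrow> 'a cdual \<Rightarrow> 'a cdual" is "\<lambda>\<phi> \<psi> x. \<phi> x + \<psi> x"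
  by (simp add: clinear_iff scaleC_add_right bounded_linear_add)

lift_definition minus_cdual :: "'a cdual \<Rightarrow> 'a cdual \<Rightarrow> 'a cdual" is "\<lambda>\<phi> \<psi> x. \<phi> x - \<psi> x"
  by (simp add: clinear_iff complex_vector.scale_right_diff_distrib bounded_linear_sub)

lift_definition uminus_cdual :: "'a cdual \<Rightarrow> 'a cdual" is "\<lambda>\<phi> x. - \<phi> x"
  by (simp add: clinear_iff bounded_linear_minus)

lift_definition scaleR_cdual :: "real \<Rightarrow> 'a cdual \<Rightarrow> 'a cdual" is "\<lambda>r \<phi> x. r *\<^sub>R \<phi> x"
  by (simp add: clinear_iff scaleC_add_right scaleC_scaleC mult.commute
        bounded_linear_compose_scaleC flip: scaleC_of_real)

lift_definition scaleC_cdual :: "complex \<Rightarrow> 'a cdual \<Rightarrow> 'a cdual" is "\<lambda>c \<phi> x. c *\<^sub>C \<phi> x"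
  by (simp add: clinear_iff scaleC_add_right scaleC_scaleC mult.commute
        bounded_linear_compose_scaleC)

lift_definition norm_cdual :: "'a cdual \<Rightarrow> real" is onorm .

definition sgn_cdual :: "'a cdual \<Rightarrow> 'a cdual"
  where "sgn_cdual \<phi> = inverse (norm \<phi>) *\<^sub>R \<phi>"

definition dist_cdual :: "'a cdual \<Rightarrow> 'a cdual \<Rightarrow> real"
  where "dist_cdual \<phi> \<psi> = norm (\<phi> - \<psi>)"

definition uniformity_cdual :: "('a cdual \<times> 'a cdual) filter"
  where "uniformity_cdual = (INF e\<in>{0<..}. principal {(\<phi>, \<psi>). dist \<phi> \<psi> < e})"

definition open_cdual :: "'a cdual set \<Rightarrow> bool"
  where "open_cdual S \<longleftrightarrow> (\<forall>\<phi>\<in>S. \<forall>\<^sub>F (\<phi>', \<psi>) in uniformity. \<phi>' = \<phi> \<longrightarrow> \<psi> \<in> S)"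

instance
  apply standard
  unfolding dist_cdual_def open_cdual_def sgn_cdual_def uniformity_cdual_def
  apply (rule refl | (transfer, force simp: onorm_triangle onorm_scaleR onorm_scaleC onorm_eq_0
      algebra_simps scaleC_add_right scaleC_add_left scaleC_scaleC scaleC_of_real))+
  done

end

definition weak_star_topology :: "'a::complex_normed_vector cdual topology"
  where "weak_star_topology = pullback_topology UNIV cdual_apply euclidean"

text \<open>
  The bounded weak* topology is the finest topology that agrees with the weak* topology on every
  norm-bounded subset: its open sets are those whose trace on each bounded set is relatively
  weak* open. The lemmas \<open>bw_star_agrees\<close> and \<open>bw_star_finest\<close> establish that property.
\<close>

definition bw_star_topology :: "'a::complex_normed_vector cdual topology"
  where "bw_star_topology =
    topology (\<lambda>U. \<forall>B. bounded B \<longrightarrow> openin (subtopology weak_star_topology B) (U \<inter> B))"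

lemma topspace_weak_star [simp]: "topspace weak_star_topology = UNIV"
  by (simp add: weak_star_topology_def topspace_pullback_topology)

lemma openin_bw_star:
  "openin bw_star_topology U \<longleftrightarrow>
    (\<forall>B. bounded B \<longrightarrow> openin (subtopology weak_star_topology B) (U \<inter> B))"
proof -
  have "istopology (\<lambda>U. \<forall>B :: 'a cdual set. bounded B \<longrightarrow>
          openin (subtopology weak_star_topology B) (U \<inter> B))" (is "istopology ?P")
    unfolding istopology_def
  proof (intro conjI allI impI)
    fix S T B :: "'a cdual set"
    assume "?P S" "?P T" "bounded B"
    then have "openin (subtopology weak_star_topology B) ((S \<inter> B) \<inter> (T \<inter> B))"
      using openin_Int[of "subtopology weak_star_topology B" "S \<inter> B" "T \<inter> B"] by simp
    then show "openin (subtopology weak_star_topology B) ((S \<inter> T) \<inter> B)"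
      by (simp add: Int_ac)
  next
    fix \<K> and B :: "'a cdual set"
    assume "\<forall>K\<in>\<K>. ?P K" "bounded B"
    then have "openin (subtopology weak_star_topology B) (\<Union>K\<in>\<K>. K \<inter> B)"
      by (intro openin_Union) auto
    then show "openin (subtopology weak_star_topology B) (\<Union>\<K> \<inter> B)"
      by (simp only: Int_Union2)
  qed
  then show ?thesis
    by (simp add: bw_star_topology_def topology_inverse')
qed

lemma openin_weak_star_imp_bw_star:
  "openin weak_star_topology U \<Longrightarrow> openin bw_star_topology U"
  by (auto simp: openin_bw_star openin_subtopology)

lemma topspace_bw_star [simp]: "topspace bw_star_topology = UNIV"
  using openin_weak_star_imp_bw_star[OF openin_topspace] openin_subset by fastforce

lemma bw_star_agrees:
  assumes "bounded B"
  shows "subtopology bw_star_topology B = subtopology weak_star_topology B"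
  unfolding topology_eq
proof (intro allI iffI)
  fix S
  assume "openin (subtopology bw_star_topology B) S"
  then show "openin (subtopology weak_star_topology B) S"
    using assms by (auto simp: openin_subtopology[of bw_star_topology] openin_bw_star)
next
  fix S
  assume "openin (subtopology weak_star_topology B) S"
  then show "openin (subtopology bw_star_topology B) S"
    by (auto simp: openin_subtopology intro: openin_weak_star_imp_bw_star)
qed

lemma bw_star_finest:
  assumes "\<And>B. bounded B \<Longrightarrow> subtopology T B = subtopology weak_star_topology B"
    and "openin T U"
  shows "openin bw_star_topology U"
  using assms by (metis openin_bw_star openin_subtopology_Int)


section \<open>Holomorphic Lipschitz maps on the open unit ball\<close>

definition holomorphic_map_on ::
    "'a::complex_normed_vector set \<Rightarrow> ('a \<Rightarrow> 'b::complex_normed_vector) \<Rightarrow> bool"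
  where "holomorphic_map_on U f \<longleftrightarrow> (\<forall>x\<in>U. \<exists>D. clinear D \<and> (f has_derivative D) (at x))"

text \<open>
  A map on the open unit ball is represented by its extension by \<open>0\<close>, so that equality of
  elements of \<open>hol_lip0\<close> is equality on the ball.
\<close>

typedef (overloaded) ('a, 'b) hol_lip0 =
  "{f :: 'a::complex_normed_vector \<Rightarrow> 'b::complex_normed_vector.
      holomorphic_map_on (ball 0 1) f \<and> (\<exists>C. C-lipschitz_on (ball 0 1) f) \<and>
      f 0 = 0 \<and> (\<forall>x. x \<notin> ball 0 1 \<longrightarrow> f x = 0)}"
  morphisms hol_lip0_apply Abs_hol_lip0
proof (rule exI[of _ "\<lambda>_. 0"])
  have "clinear (\<lambda>_ :: 'a. 0 :: 'b)"
    by (simp add: clinear_iff)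
  then show "(\<lambda>_. 0) \<in> {f :: 'a \<Rightarrow> 'b.
      holomorphic_map_on (ball 0 1) f \<and> (\<exists>C. C-lipschitz_on (ball 0 1) f) \<and>
      f 0 = 0 \<and> (\<forall>x. x \<notin> ball 0 1 \<longrightarrow> f x = 0)}"
    by (auto simp: holomorphic_map_on_def intro!: lipschitz_on_constant exI)
qed

setup_lifting type_definition_hol_lip0

text \<open>
  The element \<open>0\<close> only matters for the zero space, whose ball has no two distinct points: there
  it makes the supremum of the empty set of quotients equal to \<open>0\<close>.
\<close>

definition lip_norm :: "('a::real_normed_vector \<Rightarrow> 'b::real_normed_vector) \<Rightarrow> real"
  where "lip_norm f =
    Sup (insert 0 {norm (f x - f y) / norm (x - y) | x y. x \<in> ball 0 1 \<and> y \<in> ball 0 1 \<and> x \<noteq> y})"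

lemma lip_norm_le:
  assumes "\<And>x y. x \<in> ball 0 1 \<Longrightarrow> y \<in> ball 0 1 \<Longrightarrow> norm (f x - f y) \<le> C * norm (x - y)" "0 \<le> C"
  shows "lip_norm f \<le> C"
  unfolding lip_norm_def using assms by (intro cSup_least) (auto simp: divide_le_eq)

lemma
  assumes "C-lipschitz_on (ball 0 1) f"
  shows lip_norm_nonneg: "0 \<le> lip_norm f"
    and lip_norm_bound:
      "x \<in> ball 0 1 \<Longrightarrow> y \<in> ball 0 1 \<Longrightarrow> norm (f x - f y) \<le> lip_norm f * norm (x - y)"
proof -
  let ?S = "insert 0 {norm (f x - f y) / norm (x - y) | x y. x \<in> ball 0 1 \<and> y \<in> ball 0 1 \<and> x \<noteq> y}"
  have bdd: "bdd_above ?S"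
    using lipschitz_on_normD[OF assms] lipschitz_on_nonneg[OF assms]
    by (intro bdd_aboveI[of _ C]) (auto simp: divide_le_eq)
  show "0 \<le> lip_norm f"
    unfolding lip_norm_def by (rule cSup_upper[OF _ bdd]) simp
  assume xy: "x \<in> ball 0 1" "y \<in> ball 0 1"
  show "norm (f x - f y) \<le> lip_norm f * norm (x - y)"
  proof (cases "x = y")
    case False
    then have "norm (f x - f y) / norm (x - y) \<le> lip_norm f"
      unfolding lip_norm_def using xy by (intro cSup_upper[OF _ bdd]) auto
    then show ?thesis
      using False by (simp add: divide_le_eq)
  qed simp
qed

lemma lip_norm_triangle:
  assumes "C-lipschitz_on (ball 0 1) f" "D-lipschitz_on (ball 0 1) g"
  shows "lip_norm (\<lambda>x. f x + g x) \<le> lip_norm f + lip_norm g"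
proof (rule lip_norm_le)
  fix x y :: 'a
  assume xy: "x \<in> ball 0 1" "y \<in> ball 0 1"
  have "norm (f x + g x - (f y + g y)) \<le> norm (f x - f y) + norm (g x - g y)"
    by (metis add_diff_add norm_triangle_ineq)
  also have "\<dots> \<le> (lip_norm f + lip_norm g) * norm (x - y)"
    using lip_norm_bound[OF assms(1) xy] lip_norm_bound[OF assms(2) xy]
    by (simp add: distrib_right)
  finally show "norm (f x + g x - (f y + g y)) \<le> (lip_norm f + lip_norm g) * norm (x - y)" .
qed (use assms in \<open>simp add: lip_norm_nonneg\<close>)

lemma lip_norm_scaleC:
  assumes "C-lipschitz_on (ball 0 1) f"
  shows "lip_norm (\<lambda>x. c *\<^sub>C f x) = cmod c * lip_norm f"
proof -
  have le: "lip_norm (\<lambda>x. d *\<^sub>C g x) \<le> cmod d * lip_norm g"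
    if "E-lipschitz_on (ball 0 1) g" for g :: "'a \<Rightarrow> 'b" and d E
  proof (rule lip_norm_le)
    fix x y :: 'a
    assume "x \<in> ball 0 1" "y \<in> ball 0 1"
    then show "norm (d *\<^sub>C g x - d *\<^sub>C g y) \<le> cmod d * lip_norm g * norm (x - y)"
      using lip_norm_bound[OF that]
      by (simp add: norm_scaleC mult.assoc mult_left_mono
          flip: complex_vector.scale_right_diff_distrib)
  qed (simp add: lip_norm_nonneg[OF that])
  have lip: "(cmod c * C)-lipschitz_on (ball 0 1) (\<lambda>x. c *\<^sub>C f x)"
    using assms
    by (auto simp: lipschitz_on_def dist_norm norm_scaleC mult.assoc mult_left_mono
        simp flip: complex_vector.scale_right_diff_distrib)
  show ?thesis
  proof (cases "c = 0")
    case True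
    then show ?thesis
      using le[OF assms, of c] lip_norm_nonneg[OF lip] by simp
  next
    case False
    then have "lip_norm f \<le> cmod (inverse c) * lip_norm (\<lambda>x. c *\<^sub>C f x)"
      using le[OF lip, of "inverse c"] by (simp add: scaleC_scaleC)
    then show ?thesis
      using le[OF assms, of c] False by (simp add: norm_inverse norm_divide field_simps)
  qed
qed

lemma holomorphic_map_on_compose_clinear:
  assumes "holomorphic_map_on U f" "clinear A" "bounded_linear A"
  shows "holomorphic_map_on U (\<lambda>x. A (f x))"
  unfolding holomorphic_map_on_def
proof
  fix x assume "x \<in> U"
  then obtain D where "clinear D" "(f has_derivative D) (at x)"
    using assms by (auto simp: holomorphic_map_on_def)
  then show "\<exists>D. clinear D \<and> ((\<lambda>x. A (f x)) has_derivative D) (at x)"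
    using assms
    by (intro exI[of _ "\<lambda>h. A (D h)"]) (auto simp: clinear_iff bounded_linear.has_derivative)
qed

lemma holomorphic_map_on_add:
  assumes "holomorphic_map_on U f" "holomorphic_map_on U g"
  shows "holomorphic_map_on U (\<lambda>x. f x + g x)"
  unfolding holomorphic_map_on_def
proof
  fix x assume "x \<in> U"
  then obtain D E where "clinear D" "(f has_derivative D) (at x)"
      "clinear E" "(g has_derivative E) (at x)"
    using assms unfolding holomorphic_map_on_def by blast
  then show "\<exists>D. clinear D \<and> ((\<lambda>x. f x + g x) has_derivative D) (at x)"
    by (intro exI[of _ "\<lambda>h. D h + E h"])
       (auto simp: clinear_iff has_derivative_add scaleC_add_right)
qed

lemma lipschitz_on_compose_bounded_linear:
  fixes f :: "'a::real_normed_vector \<Rightarrow> 'b::real_normed_vector"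
  assumes "\<exists>C. C-lipschitz_on U f" "bounded_linear A"
  shows "\<exists>C. C-lipschitz_on U (\<lambda>x. A (f x))"
proof -
  obtain C where C: "C-lipschitz_on U f"
    using assms by blast
  have "(onorm A * C)-lipschitz_on U (\<lambda>x. A (f x))"
  proof (rule lipschitz_onI)
    fix x y assume "x \<in> U" "y \<in> U"
    then have "norm (f x - f y) \<le> C * norm (x - y)"
      using lipschitz_on_normD[OF C] by blast
    then have "onorm A * norm (f x - f y) \<le> onorm A * (C * norm (x - y))"
      by (rule mult_left_mono) (rule onorm_pos_le[OF assms(2)])
    then show "dist (A (f x)) (A (f y)) \<le> onorm A * C * dist x y"
      using onorm[OF assms(2), of "f x - f y"]
      by (simp add: dist_norm mult.assoc linear_diff[OF bounded_linear.linear[OF assms(2)]])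
  qed (use onorm_pos_le[OF assms(2)] lipschitz_on_nonneg[OF C] in simp)
  then show ?thesis by blast
qed

instantiation hol_lip0 :: (complex_normed_vector, complex_normed_vector) complex_normed_vector
begin

lift_definition zero_hol_lip0 :: "('a, 'b) hol_lip0" is "\<lambda>_. 0"
proof -
  have "clinear (\<lambda>_ :: 'a. 0 :: 'b)"
    by (simp add: clinear_iff)
  then show "holomorphic_map_on (ball 0 1) (\<lambda>_ :: 'a. 0 :: 'b) \<and>
      (\<exists>C. C-lipschitz_on (ball 0 1) (\<lambda>_ :: 'a. 0 :: 'b)) \<and>
      (0 :: 'b) = 0 \<and> (\<forall>x :: 'a. x \<notin> ball 0 1 \<longrightarrow> (0 :: 'b) = 0)"
    by (auto simp: holomorphic_map_on_def intro!: lipschitz_on_constant exI)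
qed

lift_definition scaleC_hol_lip0 :: "complex \<Rightarrow> ('a, 'b) hol_lip0 \<Rightarrow> ('a, 'b) hol_lip0"
  is "\<lambda>c f x. c *\<^sub>C f x"
proof -
  fix c and f :: "'a \<Rightarrow> 'b"
  have "clinear (\<lambda>x :: 'b. c *\<^sub>C x)"
    by (simp add: clinear_iff scaleC_add_right scaleC_scaleC mult.commute)
  moreover assume "holomorphic_map_on (ball 0 1) f \<and> (\<exists>C. C-lipschitz_on (ball 0 1) f) \<and>
      f 0 = 0 \<and> (\<forall>x. x \<notin> ball 0 1 \<longrightarrow> f x = 0)"
  ultimately show "holomorphic_map_on (ball 0 1) (\<lambda>x. c *\<^sub>C f x) \<and>
      (\<exists>C. C-lipschitz_on (ball 0 1) (\<lambda>x. c *\<^sub>C f x)) \<and>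
      c *\<^sub>C f 0 = 0 \<and> (\<forall>x. x \<notin> ball 0 1 \<longrightarrow> c *\<^sub>C f x = 0)"
    using holomorphic_map_on_compose_clinear[of _ f "\<lambda>x. c *\<^sub>C x"]
      lipschitz_on_compose_bounded_linear[of _ f "\<lambda>x. c *\<^sub>C x"]
    by (metis bounded_linear_scaleC_right complex_vector.scale_zero_right)
qed

lift_definition plus_hol_lip0 :: "('a, 'b) hol_lip0 \<Rightarrow> ('a, 'b) hol_lip0 \<Rightarrow> ('a, 'b) hol_lip0"
  is "\<lambda>f g x. f x + g x"
  by (auto simp: holomorphic_map_on_add intro: lipschitz_on_add)

definition uminus_hol_lip0 :: "('a, 'b) hol_lip0 \<Rightarrow> ('a, 'b) hol_lip0"
  where "uminus_hol_lip0 f = (-1) *\<^sub>C f"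

definition minus_hol_lip0 :: "('a, 'b) hol_lip0 \<Rightarrow> ('a, 'b) hol_lip0 \<Rightarrow> ('a, 'b) hol_lip0"
  where "minus_hol_lip0 f g = f + (- g)"

definition scaleR_hol_lip0 :: "real \<Rightarrow> ('a, 'b) hol_lip0 \<Rightarrow> ('a, 'b) hol_lip0"
  where "scaleR_hol_lip0 r f = complex_of_real r *\<^sub>C f"

lift_definition norm_hol_lip0 :: "('a, 'b) hol_lip0 \<Rightarrow> real" is lip_norm .

definition sgn_hol_lip0 :: "('a, 'b) hol_lip0 \<Rightarrow> ('a, 'b) hol_lip0"
  where "sgn_hol_lip0 f = inverse (norm f) *\<^sub>R f"

definition dist_hol_lip0 :: "('a, 'b) hol_lip0 \<Rightarrow> ('a, 'b) hol_lip0 \<Rightarrow> real"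
  where "dist_hol_lip0 f g = norm (f - g)"

definition uniformity_hol_lip0 :: "(('a, 'b) hol_lip0 \<times> ('a, 'b) hol_lip0) filter"
  where "uniformity_hol_lip0 = (INF e\<in>{0<..}. principal {(f, g). dist f g < e})"

definition open_hol_lip0 :: "('a, 'b) hol_lip0 set \<Rightarrow> bool"
  where "open_hol_lip0 S \<longleftrightarrow> (\<forall>f\<in>S. \<forall>\<^sub>F (f', g) in uniformity. f' = f \<longrightarrow> g \<in> S)"

instance
proof
  fix a b :: real and c d :: complex and f g h :: "('a, 'b) hol_lip0"
  show "f + g + h = f + (g + h)" "f + g = g + f" "0 + f = f"
    by (transfer; simp add: algebra_simps)+
  show addR: "c *\<^sub>C (f + g) = c *\<^sub>C f + c *\<^sub>C g" for c
    by transfer (simp add: scaleC_add_right)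
  show addL: "(c + d) *\<^sub>C f = c *\<^sub>C f + d *\<^sub>C f" for c d
    by transfer (simp add: scaleC_add_left)
  show mult: "c *\<^sub>C (d *\<^sub>C f) = (c * d) *\<^sub>C f" for c d
    by transfer (simp add: scaleC_scaleC)
  have one: "1 *\<^sub>C f = f" and zero: "0 *\<^sub>C f = 0"
    by (transfer; simp)+
  show "- f + f = 0"
    using addL[of "-1" 1] by (simp add: uminus_hol_lip0_def one zero)
  show "f - g = f + - g"
    by (simp add: minus_hol_lip0_def)
  show "complex_of_real a *\<^sub>C f = a *\<^sub>R f"
    by (simp add: scaleR_hol_lip0_def)
  show "a *\<^sub>R (f + g) = a *\<^sub>R f + a *\<^sub>R g" "(a + b) *\<^sub>R f = a *\<^sub>R f + b *\<^sub>R f"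
    "a *\<^sub>R b *\<^sub>R f = (a * b) *\<^sub>R f" "1 *\<^sub>R f = f"
    by (simp_all add: scaleR_hol_lip0_def addR addL mult one)
  show "dist f g = norm (f - g)"
    by (simp add: dist_hol_lip0_def)
  show "sgn f = inverse (norm f) *\<^sub>R f"
    by (simp add: sgn_hol_lip0_def)
  show "uniformity = (INF e\<in>{0<..}. principal {(f, g :: ('a, 'b) hol_lip0). dist f g < e})"
    by (simp add: uniformity_hol_lip0_def)
  show "open S \<longleftrightarrow> (\<forall>f\<in>S. \<forall>\<^sub>F (f', g) in uniformity. f' = f \<longrightarrow> g \<in> S)"
    for S :: "('a, 'b) hol_lip0 set"
    by (simp add: open_hol_lip0_def)
  show normC: "norm (c *\<^sub>C f) = cmod c * norm f" for c
    by transfer (auto simp: lip_norm_scaleC)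
  show "norm (a *\<^sub>R f) = \<bar>a\<bar> * norm f"
    by (simp add: scaleR_hol_lip0_def normC)
  show "norm (f + g) \<le> norm f + norm g"
    by transfer (auto intro: lip_norm_triangle)
  have norm_0: "norm (0 :: ('a, 'b) hol_lip0) = 0"
    using normC[of 0] unfolding zero by (simp only: norm_zero mult_zero_left)
  show "norm f = 0 \<longleftrightarrow> f = 0"
  proof
    assume 0: "norm f = 0"
    obtain C where C: "C-lipschitz_on (ball 0 1) (hol_lip0_apply f)"
      using hol_lip0_apply[of f] by blast
    have "hol_lip0_apply f x = 0" for x
    proof (cases "x \<in> ball 0 1")
      case True
      then have "norm (hol_lip0_apply f x - hol_lip0_apply f 0) \<le> norm f * norm (x - 0)"
        unfolding norm_hol_lip0.rep_eq by (rule lip_norm_bound[OF C]) simp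
      then show ?thesis
        using hol_lip0_apply[of f] by (simp add: 0)
    next
      case False
      then show ?thesis
        using hol_lip0_apply[of f] by blast
    qed
    then show "f = 0"
      by (simp add: zero_hol_lip0.rep_eq fun_eq_iff flip: hol_lip0_apply_inject)
  qed (simp only: norm_0)
qed

end

definition Im_L :: "('a::complex_normed_vector, 'b::complex_normed_vector) hol_lip0 \<Rightarrow> 'b set"
  where "Im_L f = {(hol_lip0_apply f x - hol_lip0_apply f y) /\<^sub>R norm (x - y) | x y.
    x \<in> ball 0 1 \<and> y \<in> ball 0 1 \<and> x \<noteq> y}"

definition compact_hol_lip0 :: "('a::complex_normed_vector, 'b::complex_normed_vector) hol_lip0 set"
  where "compact_hol_lip0 = {f. compact (closure (Im_L f))}"

lift_definition hol_transpose ::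
    "('a::complex_normed_vector, 'b::complex_normed_vector) hol_lip0 \<Rightarrow> 'b cdual
      \<Rightarrow> ('a, complex) hol_lip0"
  is "\<lambda>f \<phi> x. \<phi> (f x)"
proof -
  fix f :: "'a \<Rightarrow> 'b" and \<phi> :: "'b \<Rightarrow> complex"
  assume "holomorphic_map_on (ball 0 1) f \<and> (\<exists>C. C-lipschitz_on (ball 0 1) f) \<and>
      f 0 = 0 \<and> (\<forall>x. x \<notin> ball 0 1 \<longrightarrow> f x = 0)" "clinear \<phi> \<and> bounded_linear \<phi>"
  then show "holomorphic_map_on (ball 0 1) (\<lambda>x. \<phi> (f x)) \<and>
      (\<exists>C. C-lipschitz_on (ball 0 1) (\<lambda>x. \<phi> (f x))) \<and>
      \<phi> (f 0) = 0 \<and> (\<forall>x. x \<notin> ball 0 1 \<longrightarrow> \<phi> (f x) = 0)"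
    using linear_0[OF bounded_linear.linear, of \<phi>] holomorphic_map_on_compose_clinear[of _ f \<phi>]
      lipschitz_on_compose_bounded_linear[of _ f \<phi>]
    by metis
qed

definition bw_star_operators :: "('b::complex_normed_vector cdual \<Rightarrow> 'c::complex_normed_vector) set"
  where "bw_star_operators = {T. clinear T \<and> continuous_map bw_star_topology euclidean T}"


section \<open>The two spaces are normed spaces\<close>

lemma subspace_compact_hol_lip0: "complex_vector.subspace compact_hol_lip0"
proof (rule complex_vector.subspaceI)
  have "Im_L (0 :: ('a, 'b) hol_lip0) \<subseteq> {0}"
    by (auto simp: Im_L_def zero_hol_lip0.rep_eq)
  then have "closure (Im_L (0 :: ('a, 'b) hol_lip0)) \<subseteq> {0}"
    by (rule closure_minimal) simp
  then have "finite (closure (Im_L (0 :: ('a, 'b) hol_lip0)))"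
    by (rule finite_subset) simp
  then show "(0 :: ('a, 'b) hol_lip0) \<in> compact_hol_lip0"
    by (simp add: compact_hol_lip0_def finite_imp_compact)
next
  fix f g :: "('a, 'b) hol_lip0"
  assume "f \<in> compact_hol_lip0" "g \<in> compact_hol_lip0"
  then have *: "compact {u + v | u v. u \<in> closure (Im_L f) \<and> v \<in> closure (Im_L g)}"
    by (intro compact_sums) (simp_all add: compact_hol_lip0_def)
  have "Im_L (f + g) \<subseteq> {u + v | u v. u \<in> closure (Im_L f) \<and> v \<in> closure (Im_L g)}"
  proof
    fix z assume "z \<in> Im_L (f + g)"
    then obtain x y where xy: "x \<in> ball 0 1" "y \<in> ball 0 1" "x \<noteq> y"
      and z: "z = (hol_lip0_apply f x + hol_lip0_apply g x
        - (hol_lip0_apply f y + hol_lip0_apply g y)) /\<^sub>R norm (x - y)"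
      by (auto simp: Im_L_def plus_hol_lip0.rep_eq)
    have "z = (hol_lip0_apply f x - hol_lip0_apply f y) /\<^sub>R norm (x - y)
        + (hol_lip0_apply g x - hol_lip0_apply g y) /\<^sub>R norm (x - y)"
      by (simp add: z algebra_simps)
    moreover have "(hol_lip0_apply k x - hol_lip0_apply k y) /\<^sub>R norm (x - y) \<in> closure (Im_L k)"
      for k :: "('a, 'b) hol_lip0"
      by (rule subsetD[OF closure_subset]) (use xy in \<open>auto simp: Im_L_def\<close>)
    ultimately show "z \<in> {u + v | u v. u \<in> closure (Im_L f) \<and> v \<in> closure (Im_L g)}"
      by blast
  qed
  then have "closure (Im_L (f + g))
      \<subseteq> {u + v | u v. u \<in> closure (Im_L f) \<and> v \<in> closure (Im_L g)}"
    by (rule closure_minimal) (rule compact_imp_closed[OF *])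
  then show "f + g \<in> compact_hol_lip0"
    using compact_Int_closed[OF * closed_closure, of "Im_L (f + g)"]
    by (simp add: compact_hol_lip0_def Int_absorb1)
next
  fix c and f :: "('a, 'b) hol_lip0"
  assume "f \<in> compact_hol_lip0"
  then have *: "compact ((\<lambda>z. c *\<^sub>C z) ` closure (Im_L f))"
    by (intro compact_continuous_image linear_continuous_on bounded_linear_scaleC_right)
       (simp add: compact_hol_lip0_def)
  have "Im_L (c *\<^sub>C f) \<subseteq> (\<lambda>z. c *\<^sub>C z) ` closure (Im_L f)"
  proof
    fix z assume "z \<in> Im_L (c *\<^sub>C f)"
    then obtain x y where xy: "x \<in> ball 0 1" "y \<in> ball 0 1" "x \<noteq> y"
      and z: "z = (c *\<^sub>C hol_lip0_apply f x - c *\<^sub>C hol_lip0_apply f y) /\<^sub>R norm (x - y)"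
      by (auto simp: Im_L_def scaleC_hol_lip0.rep_eq)
    have "z = c *\<^sub>C ((hol_lip0_apply f x - hol_lip0_apply f y) /\<^sub>R norm (x - y))"
      unfolding z
      by (simp only: scaleC_scaleC mult.commute flip: scaleC_of_real
          complex_vector.scale_right_diff_distrib)
    moreover have "(hol_lip0_apply f x - hol_lip0_apply f y) /\<^sub>R norm (x - y) \<in> closure (Im_L f)"
      by (rule subsetD[OF closure_subset]) (use xy in \<open>auto simp: Im_L_def\<close>)
    ultimately show "z \<in> (\<lambda>z. c *\<^sub>C z) ` closure (Im_L f)"
      by blast
  qed
  then have "closure (Im_L (c *\<^sub>C f)) \<subseteq> (\<lambda>z. c *\<^sub>C z) ` closure (Im_L f)"
    by (rule closure_minimal) (rule compact_imp_closed[OF *])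
  then show "c *\<^sub>C f \<in> compact_hol_lip0"
    using compact_Int_closed[OF * closed_closure, of "Im_L (c *\<^sub>C f)"]
    by (simp add: compact_hol_lip0_def Int_absorb1)
qed

lemma bw_star_operators_add:
  assumes "S \<in> bw_star_operators" "T \<in> bw_star_operators"
  shows "(\<lambda>\<phi>. S \<phi> + T \<phi>) \<in> bw_star_operators"
  using assms
  by (auto simp: bw_star_operators_def clinear_iff scaleC_add_right intro: continuous_map_add)

lemma bw_star_operators_scaleC:
  assumes "T \<in> bw_star_operators"
  shows "(\<lambda>\<phi>. c *\<^sub>C T \<phi>) \<in> bw_star_operators"
proof -
  have "continuous_map euclidean euclidean (\<lambda>z :: 'b. c *\<^sub>C z)"
    using linear_continuous_on[OF bounded_linear_scaleC_right] by simp
  then have "continuous_map bw_star_topology euclidean ((\<lambda>z. c *\<^sub>C z) \<circ> T)"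
    using assms by (intro continuous_map_compose) (auto simp: bw_star_operators_def)
  then show ?thesis
    using assms
    by (auto simp: bw_star_operators_def clinear_iff scaleC_add_right scaleC_scaleC mult.commute o_def)
qed

text \<open>Operators in the target space are bounded, so that \<^const>\<open>onorm\<close> is their operator norm.\<close>

lemma openin_weak_star_imp_open:
  assumes "openin weak_star_topology U"
  shows "open U"
proof -
  have "bounded_linear (\<lambda>\<phi> :: 'a cdual. cdual_apply \<phi> x)" for x
  proof (rule bounded_linear_intro[where K = "norm x"])
    fix \<phi> \<psi> :: "'a cdual" and r
    show "cdual_apply (\<phi> + \<psi>) x = cdual_apply \<phi> x + cdual_apply \<psi> x"
      by (simp add: plus_cdual.rep_eq)
    show "cdual_apply (r *\<^sub>R \<phi>) x = r *\<^sub>R cdual_apply \<phi> x"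
      by (simp add: scaleR_cdual.rep_eq)
    show "norm (cdual_apply \<phi> x) \<le> norm \<phi> * norm x"
      using cdual_apply[of \<phi>] by (simp add: norm_cdual.rep_eq onorm)
  qed
  then have "continuous_on UNIV (\<lambda>\<phi> :: 'a cdual. cdual_apply \<phi>)"
    by (intro continuous_on_coordinatewise_then_product linear_continuous_on)
  moreover obtain V where "open V" "U = cdual_apply -` V"
    using assms by (auto simp: weak_star_topology_def openin_pullback_topology)
  ultimately show ?thesis
    by (simp add: open_vimage)
qed

lemma bw_star_operators_bounded_linear:
  assumes "T \<in> bw_star_operators"
  shows "bounded_linear T"
proof -
  have lin: "linear T"
    using assms by (simp add: bw_star_operators_def clinear_imp_linear)
  have "openin bw_star_topology (T -` ball 0 1)"
    using assms openin_continuous_map_preimage[of bw_star_topology euclidean T "ball 0 1"]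
    by (simp add: bw_star_operators_def vimage_def)
  then obtain V where V: "openin weak_star_topology V" "T -` ball 0 1 \<inter> ball 0 1 = V \<inter> ball 0 1"
    unfolding openin_bw_star openin_subtopology by (meson bounded_ball)
  have "open (V \<inter> ball 0 1)"
    using V(1) openin_weak_star_imp_open by blast
  moreover have "0 \<in> V \<inter> ball 0 1"
    unfolding V(2)[symmetric] by (simp add: linear_0[OF lin])
  ultimately obtain e where e: "e > 0" "cball 0 e \<subseteq> V \<inter> ball 0 1"
    using open_contains_cball by blast
  have bound: "norm (T \<phi>) \<le> norm \<phi> * (1 / e)" for \<phi>
  proof (cases "\<phi> = 0")
    case False
    have "(e / norm \<phi>) *\<^sub>R \<phi> \<in> cball 0 e"
      using False e(1) by simp
    then have "norm (T ((e / norm \<phi>) *\<^sub>R \<phi>)) < 1"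
      using e(2) V(2) by (metis IntD1 dist_0_norm mem_ball subsetD vimageD)
    then show ?thesis
      using False e(1) by (simp add: linear_scale[OF lin] field_simps)
  qed (simp add: linear_0[OF lin])
  show ?thesis
    using linear_add[OF lin] linear_scale[OF lin] bound by (rule bounded_linear_intro)
qed

end

theory Submission
  imports Defs "HOL-Complex_Analysis.Cauchy_Integral_Formula"
begin

text \<open>
  The operators in question are described by a family of inequalities. A linear map \<open>T\<close> on the dual \<open>Y\<^sup>*\<close> is
  continuous from the bounded weak* topology to the norm iff for every \<open>\<epsilon> > 0\<close> there are a finite set
  \<open>F\<close> in \<open>Y\<close> and a constant \<open>r\<close> with
  \<open>\<parallel>T \<phi>\<parallel> \<le> \<epsilon> \<parallel>\<phi>\<parallel> + r (\<Sum>y\<in>F. \<bar>\<phi> y\<bar>)\<close> for all \<open>\<phi>\<close>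
  (\<open>bw_star_operators_finitely_controlled\<close>, \<open>finitely_controlled_bw_star_operators\<close>).

  If \<open>f\<close> is compact, an \<open>\<epsilon>\<close>-net \<open>F\<close> of the set of its difference quotients gives such an inequality
  for its transpose, with \<open>r = 1\<close>: the Lipschitz norm of \<open>\<phi> \<circ> f\<close> is the supremum of \<open>\<bar>\<phi>\<bar>\<close> over
  these quotients.

  Conversely, let \<open>T\<close> satisfy these inequalities, with values in a normed space \<open>W\<close>. For a functional
  \<open>\<mu>\<close> on \<open>W\<close> with \<open>\<parallel>\<mu>\<parallel> \<le> 1\<close>, the functional \<open>\<mu> \<circ> T\<close> obeys the same bound, and the Hahn--Banach
  theorem splits it as a part of norm at most \<open>\<epsilon>\<close> plus evaluation at a point \<open>\<Sum>y\<in>F. c y *\<^sub>C y\<close> with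
  \<open>\<bar>c y\<bar> \<le> r\<close> (\<open>combination_near_functional\<close>). This has two consequences. As \<open>\<epsilon>\<close> tends to \<open>0\<close>, the
  points form a Cauchy sequence, so by completeness of \<open>Y\<close> the functional \<open>\<mu> \<circ> T\<close> is evaluation at
  some \<open>S \<mu>\<close>. Secondly, \<open>S\<close> maps the unit ball into the \<open>\<epsilon>\<close>-neighbourhood of a compact set, namely the
  set of combinations with coefficients bounded by \<open>r\<close>. So \<open>T\<close> has a compact pre-adjoint
  \<open>S\<close> (\<open>compact_preadjoint\<close>).

  For \<open>W\<close> the space of scalar holomorphic Lipschitz functions, write \<open>\<delta> x\<close> for evaluation at \<open>x\<close>. The
  map \<open>\<delta>\<close> from the ball to the dual of \<open>W\<close> is holomorphic and 1-Lipschitz, so \<open>f = S \<circ> \<delta>\<close> is a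
  holomorphic Lipschitz map. Its difference quotients lie in the image of the unit ball under \<open>S\<close>, so it is
  compact, and \<open>\<phi> (f x) = (\<delta> x) (T \<phi>) = (T \<phi>) x\<close> says that its transpose is \<open>T\<close>. Injectivity and the
  equality of norms follow because functionals of norm at most 1 recover the norm of a vector.
\<close>

section \<open>Sublinear functionals and the Hahn--Banach theorem\<close>

definition sublinear :: "('v::real_vector \<Rightarrow> real) \<Rightarrow> bool"
  where "sublinear p \<longleftrightarrow>
    (\<forall>v w. p (v + w) \<le> p v + p w) \<and> (\<forall>t v. 0 < t \<longrightarrow> p (t *\<^sub>R v) = t * p v)"

lemma sublinear_add: "sublinear p \<Longrightarrow> p (v + w) \<le> p v + p w"
  and sublinear_scale: "sublinear p \<Longrightarrow> 0 < t \<Longrightarrow> p (t *\<^sub>R v) = t * p v"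
  by (simp_all add: sublinear_def)

lemma sublinear_zero: "sublinear p \<Longrightarrow> p 0 = 0"
  using sublinear_scale[of p 2 0] by simp

lemma sublinear_minus: "sublinear p \<Longrightarrow> - p (- v) \<le> p v"
  using sublinear_add[of p v "- v"] by (simp add: sublinear_zero)

lemma sublinearI:
  assumes add: "\<And>v w. p (v + w) \<le> p v + p w"
    and le: "\<And>t v. 0 < t \<Longrightarrow> p (t *\<^sub>R v) \<le> t * p v"
  shows "sublinear p"
  unfolding sublinear_def
proof (intro conjI allI impI)
  fix t :: real and v :: 'a
  assume t: "0 < t"
  have "p (inverse t *\<^sub>R (t *\<^sub>R v)) \<le> inverse t * p (t *\<^sub>R v)"
    using t by (intro le) simp
  then have "t * p v \<le> p (t *\<^sub>R v)"
    using t by (simp add: field_simps)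
  then show "p (t *\<^sub>R v) = t * p v"
    using le[OF t] by (simp add: order_antisym)
qed (rule add)

text \<open>
  A pair \<open>(w, a)\<close> in the cone is a constraint \<open>a \<le> l w\<close> imposed on a linear functional \<open>l \<le> p\<close>. Such
  constraints can be added and scaled, so a family of them may be taken to be a convex cone.
\<close>

definition dominated_cone :: "('v::real_vector \<Rightarrow> real) \<Rightarrow> ('v \<times> real) set \<Rightarrow> bool"
  where "dominated_cone p C \<longleftrightarrow> (0, 0) \<in> C \<and> (\<forall>c\<in>C. \<forall>d\<in>C. c + d \<in> C)
    \<and> (\<forall>t>0. \<forall>c\<in>C. t *\<^sub>R c \<in> C) \<and> (\<forall>(w, a)\<in>C. a \<le> p w)"

text \<open>
  The cone generated by the single constraint \<open>p w \<le> l w\<close>.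
\<close>

definition ray :: "('v::real_vector \<Rightarrow> real) \<Rightarrow> 'v \<Rightarrow> ('v \<times> real) set"
  where "ray p w = {(t *\<^sub>R w, t * p w) | t. 0 \<le> t}"

lemma ray_base: "(w, p w) \<in> ray p w"
  by (auto simp: ray_def intro!: exI[of _ 1])

lemma dominated_cone_ray:
  assumes p: "sublinear p"
  shows "dominated_cone p (ray p w)"
  unfolding dominated_cone_def
proof (intro conjI ballI allI impI)
  show "(0, 0) \<in> ray p w"
    by (auto simp: ray_def intro!: exI[of _ 0])
next
  fix c d assume "c \<in> ray p w" "d \<in> ray p w"
  then obtain s t where "c = (s *\<^sub>R w, s * p w)" "d = (t *\<^sub>R w, t * p w)" "0 \<le> s" "0 \<le> t"
    by (auto simp: ray_def)
  then show "c + d \<in> ray p w"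
    by (auto simp: ray_def algebra_simps intro!: exI[of _ "s + t"])
next
  fix t :: real and c assume "0 < t" "c \<in> ray p w"
  then obtain s where "c = (s *\<^sub>R w, s * p w)" "0 \<le> s"
    by (auto simp: ray_def)
  then show "t *\<^sub>R c \<in> ray p w"
    using \<open>0 < t\<close> by (auto simp: ray_def intro!: exI[of _ "t * s"])
next
  fix c assume "c \<in> ray p w"
  then obtain s where "c = (s *\<^sub>R w, s * p w)" "0 \<le> s"
    by (auto simp: ray_def)
  then show "case c of (v, a) \<Rightarrow> a \<le> p v"
    by (cases "s = 0") (auto simp: sublinear_zero[OF p] sublinear_scale[OF p])
qed

text \<open>
  The witness is \<open>v \<mapsto> INF (w, a)\<in>C. p (v + w) - a\<close>: the pair \<open>(0, 0)\<close> shows that it is at most \<open>p\<close>,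
  and the pair \<open>(w, a)\<close> itself gives the bound at \<open>- w\<close>. Since \<open>a \<le> p w \<le> p (v + w) + p (- v)\<close>,
  the infimum is finite.
\<close>

lemma sublinear_below_cone:
  assumes p: "sublinear p" and C: "dominated_cone p C"
  shows "\<exists>q. sublinear q \<and> q \<le> p \<and> (\<forall>(w, a)\<in>C. q (- w) \<le> - a)"
proof -
  define q where "q v = (INF (w, a)\<in>C. p (v + w) - a)" for v
  have C0: "(0, 0) \<in> C"
    and Cadd: "\<And>w a w' a'. (w, a) \<in> C \<Longrightarrow> (w', a') \<in> C \<Longrightarrow> (w + w', a + a') \<in> C"
    and Cscale: "\<And>t w a. 0 < t \<Longrightarrow> (w, a) \<in> C \<Longrightarrow> (t *\<^sub>R w, t * a) \<in> C"
    and Cle: "\<And>w a. (w, a) \<in> C \<Longrightarrow> a \<le> p w"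
    using C unfolding dominated_cone_def by force+
  have bdd: "bdd_below ((\<lambda>(w, a). p (v + w) - a) ` C)" for v
  proof (intro bdd_belowI2[where m = "- p (- v)"])
    fix c assume "c \<in> C"
    then show "- p (- v) \<le> (case c of (w, a) \<Rightarrow> p (v + w) - a)"
      using sublinear_add[OF p, of "- v" "v + fst c"] Cle[of "fst c" "snd c"]
      by (auto split: prod.splits)
  qed
  have upper: "q v \<le> p (v + w) - a" if "(w, a) \<in> C" for v w a
    unfolding q_def using cINF_lower[OF bdd that] by simp
  have lower: "b \<le> q v" if "\<And>w a. (w, a) \<in> C \<Longrightarrow> b \<le> p (v + w) - a" for v b
    unfolding q_def using C0 that by (intro cINF_greatest) auto
  have "sublinear q"
  proof (rule sublinearI)
    fix v v'
    have "q (v + v') - (p (v' + w') - a') \<le> q v" if c': "(w', a') \<in> C" for w' a'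
    proof (rule lower)
      fix w a assume c: "(w, a) \<in> C"
      have "q (v + v') \<le> p ((v + w) + (v' + w')) - (a + a')"
        using upper[OF Cadd[OF c c'], of "v + v'"] by (simp add: algebra_simps)
      then show "q (v + v') - (p (v' + w') - a') \<le> p (v + w) - a"
        using sublinear_add[OF p, of "v + w" "v' + w'"] by simp
    qed
    then have "q (v + v') - q v \<le> q v'"
      by (intro lower) (simp add: algebra_simps)
    then show "q (v + v') \<le> q v + q v'" by simp
  next
    fix t :: real and v
    assume t: "0 < t"
    have "q (t *\<^sub>R v) / t \<le> q v"
    proof (rule lower)
      fix w a assume "(w, a) \<in> C"
      then have "q (t *\<^sub>R v) \<le> p (t *\<^sub>R (v + w)) - t * a"
        using upper[OF Cscale[OF t]] by (simp add: scaleR_add_right)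
      then show "q (t *\<^sub>R v) / t \<le> p (v + w) - a"
        unfolding sublinear_scale[OF p t] using t by (simp add: field_simps)
    qed
    then show "q (t *\<^sub>R v) \<le> t * q v"
      using t by (simp add: field_simps)
  qed
  moreover have "q \<le> p"
    using upper[OF C0] by (simp add: le_fun_def)
  moreover have "q (- w) \<le> - a" if "(w, a) \<in> C" for w a
    using upper[OF that, of "- w"] by (simp add: sublinear_zero[OF p])
  ultimately show ?thesis by blast
qed

lemma sublinear_chain_INF:
  assumes "K \<noteq> {}" and sub: "\<And>q. q \<in> K \<Longrightarrow> sublinear q"
    and below: "\<And>q. q \<in> K \<Longrightarrow> q \<le> p"
    and chain: "\<And>q r. q \<in> K \<Longrightarrow> r \<in> K \<Longrightarrow> q \<le> r \<or> r \<le> q"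
  shows "\<exists>m. sublinear m \<and> (\<forall>q\<in>K. m \<le> q)"
proof -
  define m where "m v = (INF q\<in>K. q v)" for v
  have bdd: "bdd_below ((\<lambda>q. q v) ` K)" for v
  proof (intro bdd_belowI2[where m = "- p (- v)"])
    fix q assume "q \<in> K"
    then show "- p (- v) \<le> q v"
      using sublinear_minus[OF sub, of q v] le_funD[OF below, of q "- v"] by simp
  qed
  have upper: "m v \<le> q v" if "q \<in> K" for q v
    unfolding m_def by (rule cINF_lower[OF bdd that])
  have lower: "b \<le> m v" if "\<And>q. q \<in> K \<Longrightarrow> b \<le> q v" for b v
    unfolding m_def using \<open>K \<noteq> {}\<close> that by (rule cINF_greatest)
  have "sublinear m"
  proof (rule sublinearI)
    fix v w
    have *: "m (v + w) \<le> q v + r w" if "q \<in> K" "r \<in> K" for q r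
      using chain[OF that]
    proof
      assume "q \<le> r"
      then show ?thesis
        using upper[OF that(1), of "v + w"] sublinear_add[OF sub[OF that(1)], of v w]
          le_funD[OF \<open>q \<le> r\<close>, of w] by simp
    next
      assume "r \<le> q"
      then show ?thesis
        using upper[OF that(2), of "v + w"] sublinear_add[OF sub[OF that(2)], of v w]
          le_funD[OF \<open>r \<le> q\<close>, of v] by simp
    qed
    have "m (v + w) - r w \<le> m v" if "r \<in> K" for r
      using *[OF _ that] by (intro lower) (simp add: algebra_simps)
    then have "m (v + w) - m v \<le> m w"
      by (intro lower) (simp add: algebra_simps)
    then show "m (v + w) \<le> m v + m w" by simp
  next
    fix t :: real and v
    assume t: "0 < t"
    have "m (t *\<^sub>R v) / t \<le> m v"
    proof (rule lower)
      fix q assume "q \<in> K"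
      then show "m (t *\<^sub>R v) / t \<le> q v"
        using upper[of q "t *\<^sub>R v"] t by (simp add: sublinear_scale[OF sub] field_simps)
    qed
    then show "m (t *\<^sub>R v) \<le> t * m v"
      using t by (simp add: field_simps)
  qed
  then show ?thesis
    using upper by (auto simp: le_fun_def)
qed

text \<open>
  Lowering \<open>q\<close> along the ray of \<open>w\<close> changes nothing by minimality, so \<open>q (- w) \<le> - q w\<close>. This makes \<open>q\<close>
  superadditive as well as subadditive.
\<close>

lemma linear_if_minimal_sublinear:
  assumes q: "sublinear q" and min: "\<And>r. sublinear r \<Longrightarrow> r \<le> q \<Longrightarrow> r = q"
  shows "linear q"
proof -
  have ge: "q v + q w \<le> q (v + w)" for v w
  proof -
    from sublinear_below_cone[OF q dominated_cone_ray[OF q]] obtain r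
      where r: "sublinear r" "r \<le> q" "\<forall>(v, a)\<in>ray q w. r (- v) \<le> - a"
      by blast
    then have "q (- w) \<le> - q w"
      using ray_base[of w q] min[OF r(1,2)] by auto
    then show ?thesis
      using sublinear_add[OF q, of "v + w" "- w"] by simp
  qed
  have add: "q (v + w) = q v + q w" for v w
    using ge[of v w] sublinear_add[OF q, of v w] by simp
  have minus: "q (- v) = - q v" for v
    using add[of v "- v"] by (simp add: sublinear_zero[OF q])
  show ?thesis
  proof (rule linearI)
    show "q (t *\<^sub>R v) = t *\<^sub>R q v" for t v
    proof (cases t "0 :: real" rule: linorder_cases)
      case less
      then have "q (- ((- t) *\<^sub>R v)) = - (- t * q v)"
        unfolding minus by (subst sublinear_scale[OF q]) simp_all
      then show ?thesis by simp
    qed (simp_all add: sublinear_zero[OF q] sublinear_scale[OF q])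
  qed (rule add)
qed

text \<open>
  By Zorn's lemma there is a minimal sublinear functional below \<open>p\<close>: chains have lower bounds by taking
  pointwise infima.
\<close>

lemma linear_below_sublinear:
  assumes p: "sublinear p"
  shows "\<exists>l. linear l \<and> l \<le> p"
proof -
  define A where "A = {q. sublinear q \<and> q \<le> p}"
  have "\<exists>m\<in>A. \<forall>a\<in>A. a \<le> m \<longrightarrow> a = m"
  proof (rule predicate_Zorn[of A "\<lambda>a b. b \<le> a"])
    show "partial_order_on A (relation_of (\<lambda>a b. b \<le> a) A)"
      by (auto simp: partial_order_on_def preorder_on_def refl_on_def trans_def antisym_def
          relation_of_def)
  next
    fix K assume K: "K \<in> Chains (relation_of (\<lambda>a b. b \<le> a) A)"
    show "\<exists>u\<in>A. \<forall>a\<in>K. u \<le> a"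
    proof (cases "K = {}")
      case True
      then show ?thesis
        using p by (auto simp: A_def)
    next
      case False
      have *: "q \<in> A" if "q \<in> K" for q
        using K that by (auto simp: Chains_def relation_of_def)
      have chain: "q \<le> r \<or> r \<le> q" if "q \<in> K" "r \<in> K" for q r
        using K that by (auto simp: Chains_def relation_of_def)
      have "\<exists>m. sublinear m \<and> (\<forall>q\<in>K. m \<le> q)"
        using False * chain by (intro sublinear_chain_INF[where p = p]) (auto simp: A_def)
      then obtain m where m: "sublinear m" "\<forall>q\<in>K. m \<le> q" by blast
      obtain q where "q \<in> K"
        using False by blast
      then have "m \<le> p"
        using m(2) *[of q] order_trans[of m q p] by (auto simp: A_def)
      then show ?thesis
        using m by (auto simp: A_def)
    qed
  qed
  then obtain m where m: "m \<in> A" "\<forall>a\<in>A. a \<le> m \<longrightarrow> a = m" by blast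
  have "linear m"
  proof (rule linear_if_minimal_sublinear)
    show "sublinear m"
      using m by (simp add: A_def)
    show "r = m" if "sublinear r" "r \<le> m" for r
      using m that order_trans[of r m p] by (auto simp: A_def)
  qed
  then show ?thesis
    using m by (auto simp: A_def)
qed

text \<open>
  This form of the Hahn--Banach theorem speaks of constraints instead of extensions from a subspace.
  It yields both norming functionals (a single ray of constraints) and the splitting of a functional
  dominated by a sum of two seminorms.
\<close>

theorem Mazur_Orlicz:
  assumes "sublinear p" "dominated_cone p C"
  shows "\<exists>l. linear l \<and> l \<le> p \<and> (\<forall>(w, a)\<in>C. a \<le> l w)"
proof -
  obtain q where q: "sublinear q" "q \<le> p" "\<forall>(w, a)\<in>C. q (- w) \<le> - a"
    using sublinear_below_cone[OF assms] by blast
  obtain l where l: "linear l" "l \<le> q"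
    using linear_below_sublinear[OF q(1)] by blast
  have "a \<le> l w" if "(w, a) \<in> C" for w a
    using q(3) that le_funD[OF l(2), of "- w"] by (auto simp: linear_neg[OF l(1)])
  then show ?thesis
    using l q(2) by (intro exI[of _ l]) auto
qed

section \<open>Complex functionals dominated by seminorms\<close>

definition complex_seminorm :: "('v::complex_normed_vector \<Rightarrow> real) \<Rightarrow> bool"
  where "complex_seminorm p \<longleftrightarrow>
    (\<forall>v w. p (v + w) \<le> p v + p w) \<and> (\<forall>c v. p (c *\<^sub>C v) = cmod c * p v)"

lemma complex_seminorm_sublinear: "complex_seminorm p \<Longrightarrow> sublinear p"
  unfolding complex_seminorm_def sublinear_def
  by (simp flip: scaleC_of_real)

lemma complex_seminorm_norm: "complex_seminorm (norm :: 'v::complex_normed_vector \<Rightarrow> real)"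
  by (simp add: complex_seminorm_def norm_scaleC norm_triangle_ineq)

lemma complex_seminorm_zero: "complex_seminorm p \<Longrightarrow> p 0 = 0"
  by (simp add: complex_seminorm_sublinear sublinear_zero)

lemma complex_seminorm_nonneg: "complex_seminorm p \<Longrightarrow> 0 \<le> p v"
proof -
  assume p: "complex_seminorm p"
  then have "p ((-1) *\<^sub>C v) = p v"
    unfolding complex_seminorm_def by (metis mult_1 norm_minus_cancel norm_one)
  then show ?thesis
    using sublinear_add[OF complex_seminorm_sublinear[OF p], of v "(-1) *\<^sub>C v"]
    by (simp add: complex_seminorm_zero[OF p])
qed

lemma complex_seminorm_add:
  "complex_seminorm p \<Longrightarrow> complex_seminorm q \<Longrightarrow> complex_seminorm (\<lambda>v. p v + q v)"
  by (simp add: complex_seminorm_def add_mono distrib_left add.assoc add.left_commute)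
     (metis add.assoc add.left_commute add_mono)

lemma complex_seminorm_sum_functionals:
  assumes "\<And>i. i \<in> I \<Longrightarrow> clinear (\<eta> i)" "0 \<le> r"
  shows "complex_seminorm (\<lambda>v. r * (\<Sum>i\<in>I. cmod (\<eta> i v)))"
proof -
  have "(\<Sum>i\<in>I. cmod (\<eta> i (v + w))) \<le> (\<Sum>i\<in>I. cmod (\<eta> i v)) + (\<Sum>i\<in>I. cmod (\<eta> i w))" for v w
    unfolding sum.distrib[symmetric]
    using assms(1) by (intro sum_mono) (simp add: clinear_iff norm_triangle_ineq)
  moreover have "(\<Sum>i\<in>I. cmod (\<eta> i (c *\<^sub>C v))) = cmod c * (\<Sum>i\<in>I. cmod (\<eta> i v))" for c v
    using assms(1)
    by (auto simp: sum_distrib_left clinear_iff scaleC_complex_def norm_mult intro!: sum.cong)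
  ultimately show ?thesis
    using assms(2) by (simp add: complex_seminorm_def mult_left_mono flip: distrib_left)
qed

text \<open>
  Rotating \<open>v\<close> by a unimodular scalar makes \<open>l v\<close> real and nonnegative without changing \<open>p v\<close>.
\<close>

lemma clinear_cmod_le:
  fixes l :: "'v::complex_normed_vector \<Rightarrow> complex"
  assumes "clinear l" "complex_seminorm p" "\<And>v. Re (l v) \<le> p v"
  shows "cmod (l v) \<le> p v"
proof (cases "l v = 0")
  case False
  define c where "c = cnj (sgn (l v))"
  have c: "cmod c = 1" "c * l v = of_real (cmod (l v))"
    using False
    by (simp_all add: c_def norm_sgn sgn_eq field_simps norm_divide
        complex_norm_square[symmetric] power2_eq_square)
  have "Re (l (c *\<^sub>C v)) = cmod (l v)"
    using assms(1) by (simp add: clinear_iff scaleC_complex_def c)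
  then show ?thesis
    using assms(2) assms(3)[of "c *\<^sub>C v"] by (simp add: complex_seminorm_def c)
qed (use assms in \<open>simp add: complex_seminorm_nonneg\<close>)

text \<open>
  Every complex functional has the form \<open>m v - \<i> m (\<i> v)\<close> with \<open>m\<close> its real part, so real results
  transfer to the complex case through \<open>m\<close>.
\<close>

lemma complexification:
  fixes m :: "'v::complex_normed_vector \<Rightarrow> real"
  assumes m: "linear m"
  shows "clinear (\<lambda>v. Complex (m v) (- m (\<i> *\<^sub>C v)))"
  unfolding clinear_iff
proof (intro conjI allI)
  fix c and v :: 'v
  have split: "d *\<^sub>C w = Re d *\<^sub>R w + Im d *\<^sub>R (\<i> *\<^sub>C w)" for d and w :: 'v
    by (subst complex_eq[of d])
      (simp add: scaleC_add_left scaleC_scaleC mult.commute flip: scaleC_of_real)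
  have "m (d *\<^sub>C w) = Re d * m w + Im d * m (\<i> *\<^sub>C w)" for d and w :: 'v
    by (subst split) (simp add: linear_add[OF m] linear_scale[OF m])
  from this[of c v] this[of "\<i> * c" v]
  show "Complex (m (c *\<^sub>C v)) (- m (\<i> *\<^sub>C c *\<^sub>C v)) = c *\<^sub>C Complex (m v) (- m (\<i> *\<^sub>C v))"
    by (simp add: scaleC_complex_def scaleC_scaleC complex_eq_iff)
qed (simp add: linear_add[OF m] scaleC_add_right complex_eq_iff)

lemma clinear_diff_eq:
  assumes "clinear f" "clinear g"
  shows "clinear (\<lambda>v. f v - g v)"
  using assms by (simp add: clinear_iff complex_vector.scale_right_diff_distrib)

text \<open>
  It suffices to find the real part \<open>m\<close> of \<open>l\<close> with \<open>m \<le> p\<close> and \<open>Re \<psi> - m \<le> q\<close>. The second condition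
  is the constraint \<open>Re \<psi> - q \<le> m\<close> of the Mazur--Orlicz theorem, and \<open>\<bar>\<psi>\<bar> \<le> p + q\<close> makes these
  constraints compatible with \<open>p\<close>.
\<close>

lemma split_dominated_functional:
  fixes \<psi> :: "'v::complex_normed_vector \<Rightarrow> complex"
  assumes \<psi>: "clinear \<psi>" and p: "complex_seminorm p" and q: "complex_seminorm q"
    and le: "\<And>v. cmod (\<psi> v) \<le> p v + q v"
  shows "\<exists>l. clinear l \<and> (\<forall>v. cmod (l v) \<le> p v) \<and> (\<forall>v. cmod (\<psi> v - l v) \<le> q v)"
proof -
  note sub = complex_seminorm_sublinear
  define C where "C = {(v, a). a \<le> Re (\<psi> v) - q v}"
  have lin: "linear \<psi>"
    by (rule clinear_imp_linear[OF \<psi>])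
  have "dominated_cone p C"
    unfolding dominated_cone_def
  proof (intro conjI ballI allI impI)
    show "(0, 0) \<in> C"
      by (simp add: C_def linear_0[OF lin] complex_seminorm_zero[OF q])
  next
    fix c d assume "c \<in> C" "d \<in> C"
    then show "c + d \<in> C"
      using sublinear_add[OF sub[OF q], of "fst c" "fst d"]
      by (auto simp: C_def linear_add[OF lin] split: prod.splits)
  next
    fix t :: real and c assume "0 < t" "c \<in> C"
    then show "t *\<^sub>R c \<in> C"
      by (auto simp: C_def linear_scale[OF lin] sublinear_scale[OF sub[OF q]]
          right_diff_distrib[symmetric] split: prod.splits)
  next
    fix c assume "c \<in> C"
    then show "case c of (w, a) \<Rightarrow> a \<le> p w"
      using le[of "fst c"] complex_Re_le_cmod[of "\<psi> (fst c)"] by (auto simp: C_def)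
  qed
  from Mazur_Orlicz[OF sub[OF p] this] obtain m
    where m: "linear m" "m \<le> p" and m_ge: "\<forall>(w, a)\<in>C. a \<le> m w"
    by blast
  define l where "l v = Complex (m v) (- m (\<i> *\<^sub>C v))" for v
  have l: "clinear l"
    unfolding l_def by (rule complexification[OF m(1)])
  have "cmod (l v) \<le> p v" for v
    using l p by (rule clinear_cmod_le) (simp add: l_def le_funD[OF m(2)])
  moreover have "cmod (\<psi> v - l v) \<le> q v" for v
    using clinear_diff_eq[OF \<psi> l] q
  proof (rule clinear_cmod_le)
    fix v
    have "(v, Re (\<psi> v) - q v) \<in> C"
      by (simp add: C_def)
    with m_ge have "Re (\<psi> v) - q v \<le> m v" by blast
    then show "Re (\<psi> v - l v) \<le> q v"
      by (simp add: l_def)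
  qed
  ultimately show ?thesis
    using l by blast
qed

text \<open>
  Splitting off one seminorm \<open>r \<bar>\<eta> j\<bar>\<close> at a time leaves a functional dominated by \<open>r \<bar>\<eta> j\<bar>\<close>. Such a functional
  vanishes on the kernel of \<open>\<eta> j\<close>, so it is a multiple \<open>d \<eta> j\<close> with \<open>\<bar>d\<bar> \<le> r\<close>. The bound on the
  coefficients is what later yields compactness.
\<close>

lemma approximate_by_combination:
  fixes \<eta> :: "'i \<Rightarrow> 'v::complex_normed_vector \<Rightarrow> complex"
  assumes "finite I" "\<And>i. i \<in> I \<Longrightarrow> clinear (\<eta> i)" "0 \<le> r"
    and "clinear \<psi>" "complex_seminorm p"
    and "\<And>v. cmod (\<psi> v) \<le> p v + r * (\<Sum>i\<in>I. cmod (\<eta> i v))"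
  shows "\<exists>c. (\<forall>i\<in>I. cmod (c i) \<le> r) \<and> (\<forall>v. cmod (\<psi> v - (\<Sum>i\<in>I. c i * \<eta> i v)) \<le> p v)"
  using assms
proof (induction I arbitrary: \<psi> rule: finite_induct)
  case empty
  then show ?case by simp
next
  case (insert j I)
  have j: "clinear (\<eta> j)"
    by (simp add: insert.prems)
  have sum: "complex_seminorm (\<lambda>v. r * (\<Sum>i\<in>I. cmod (\<eta> i v)))"
    by (rule complex_seminorm_sum_functionals) (auto simp: insert.prems)
  have single: "complex_seminorm (\<lambda>v. r * (\<Sum>i\<in>{j}. cmod (\<eta> i v)))"
    by (rule complex_seminorm_sum_functionals) (auto simp: insert.prems)
  have "cmod (\<psi> v) \<le> (p v + r * (\<Sum>i\<in>I. cmod (\<eta> i v))) + r * (\<Sum>i\<in>{j}. cmod (\<eta> i v))" for v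
    using insert.prems(5)[of v] insert.hyps by (simp add: algebra_simps)
  from split_dominated_functional[OF insert.prems(3)
      complex_seminorm_add[OF insert.prems(4) sum] single this]
  obtain l where l: "clinear l" "\<And>v. cmod (l v) \<le> p v + r * (\<Sum>i\<in>I. cmod (\<eta> i v))"
    and rest: "\<And>v. cmod (\<psi> v - l v) \<le> r * cmod (\<eta> j v)"
    by auto
  from insert.IH[OF _ _ l(1) insert.prems(4) l(2)] insert.prems obtain c
    where c: "\<And>i. i \<in> I \<Longrightarrow> cmod (c i) \<le> r"
      "\<And>v. cmod (l v - (\<Sum>i\<in>I. c i * \<eta> i v)) \<le> p v"
    by auto
  have "\<exists>d. cmod d \<le> r \<and> (\<forall>v. \<psi> v - l v = d * \<eta> j v)"
  proof (cases "\<exists>u. \<eta> j u \<noteq> 0")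
    case False
    then show ?thesis
      using rest insert.prems by (intro exI[of _ 0]) auto
  next
    case True
    then obtain u where u: "\<eta> j u \<noteq> 0" by blast
    define D where "D v = \<psi> v - l v" for v
    have D: "clinear D"
      unfolding D_def by (rule clinear_diff_eq[OF insert.prems(3) l(1)])
    have "D v = D u / \<eta> j u * \<eta> j v" for v
    proof -
      define w where "w = v - (\<eta> j v / \<eta> j u) *\<^sub>C u"
      have "\<eta> j w = 0"
        using u j linear_diff[OF clinear_imp_linear[OF j]]
        by (simp add: w_def clinear_iff scaleC_complex_def)
      then have "D w = 0"
        using rest[of w] by (simp add: D_def)
      moreover have "D w = D v - \<eta> j v / \<eta> j u * D u"
        using D linear_diff[OF clinear_imp_linear[OF D]]
        by (simp add: w_def clinear_iff scaleC_complex_def)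
      ultimately show ?thesis by simp
    qed
    moreover have "cmod (D u / \<eta> j u) \<le> r"
      using rest[of u] u by (simp add: D_def norm_divide field_simps)
    ultimately show ?thesis
      unfolding D_def by blast
  qed
  then obtain d where d: "cmod d \<le> r" "\<And>v. \<psi> v - l v = d * \<eta> j v" by blast
  show ?case
  proof (intro exI[of _ "c(j := d)"] conjI ballI allI)
    fix v
    have "(\<Sum>i\<in>I. (c(j := d)) i * \<eta> i v) = (\<Sum>i\<in>I. c i * \<eta> i v)"
      using insert.hyps by (intro sum.cong) auto
    moreover have "\<psi> v = l v + d * \<eta> j v"
      using d(2)[of v] by (simp add: algebra_simps)
    ultimately show "cmod (\<psi> v - (\<Sum>i\<in>insert j I. (c(j := d)) i * \<eta> i v)) \<le> p v"
      using c(2)[of v] insert.hyps by (simp add: algebra_simps)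
  qed (use c(1) d(1) in auto)
qed

section \<open>The dual space separates points and norms\<close>

lemma clinear_cdual: "clinear (cdual_apply \<phi>)"
  and bounded_linear_cdual: "bounded_linear (cdual_apply \<phi>)"
  using cdual_apply[of \<phi>] by simp_all

lemma linear_cdual: "linear (cdual_apply \<phi>)"
  by (simp add: bounded_linear_cdual bounded_linear.linear)

lemmas cdual_add = linear_add[OF linear_cdual]
  and cdual_diff = linear_diff[OF linear_cdual]
  and cdual_sum = linear_sum[OF linear_cdual]
  and cdual_scaleR = linear_scale[OF linear_cdual]

lemma cdual_scaleC: "cdual_apply \<phi> (c *\<^sub>C y) = c * cdual_apply \<phi> y"
  using clinear_cdual[of \<phi>] by (simp add: clinear_iff scaleC_complex_def)

lemma cdual_bound: "cmod (cdual_apply \<phi> y) \<le> norm \<phi> * norm y"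
  by (simp add: norm_cdual.rep_eq onorm bounded_linear_cdual)

lemma clinear_cdual_eval: "clinear (\<lambda>\<phi>. cdual_apply \<phi> y)"
  by (simp add: clinear_iff plus_cdual.rep_eq scaleC_cdual.rep_eq)

lemma cdual_exists:
  assumes "clinear l" "\<And>y. cmod (l y) \<le> b * norm y" "0 \<le> b"
  shows "\<exists>\<phi>. cdual_apply \<phi> = l \<and> norm \<phi> \<le> b"
proof -
  have "bounded_linear l"
    using clinear_imp_linear[OF assms(1)] assms(2)
    by (intro bounded_linear_intro[where K = b])
      (auto simp: linear_add linear_scale mult.commute)
  then have "cdual_apply (Abs_cdual l) = l"
    using assms(1) by (simp add: Abs_cdual_inverse)
  moreover from this have "norm (Abs_cdual l) \<le> b"
    using assms by (simp add: norm_cdual.rep_eq onorm_bound)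
  ultimately show ?thesis by blast
qed

text \<open>
  The real part is a linear functional \<open>m \<le> norm\<close> subject to the single constraint \<open>norm y \<le> m y\<close>.
\<close>

lemma norming_functional:
  fixes y :: "'a::complex_normed_vector"
  shows "\<exists>\<phi>. norm \<phi> \<le> 1 \<and> norm y \<le> cmod (cdual_apply \<phi> y)"
proof -
  have sub: "sublinear (norm :: 'a \<Rightarrow> real)"
    by (rule complex_seminorm_sublinear[OF complex_seminorm_norm])
  from Mazur_Orlicz[OF sub dominated_cone_ray[OF sub]] obtain m
    where m: "linear m" "m \<le> norm" and ge: "\<forall>(w, a)\<in>ray norm y. a \<le> m w"
    by blast
  have y: "norm y \<le> m y"
    using ge ray_base[of y norm] by blast
  define l where "l v = Complex (m v) (- m (\<i> *\<^sub>C v))" for v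
  have l: "clinear l"
    unfolding l_def by (rule complexification[OF m(1)])
  have "cmod (l v) \<le> 1 * norm v" for v
    using clinear_cmod_le[OF l complex_seminorm_norm] le_funD[OF m(2)] by (simp add: l_def)
  from cdual_exists[OF l this] obtain \<phi> where "cdual_apply \<phi> = l" "norm \<phi> \<le> 1" by auto
  moreover have "norm y \<le> cmod (l y)"
    using y complex_Re_le_cmod[of "l y"] by (simp add: l_def)
  ultimately show ?thesis by auto
qed

lemma norm_le_by_functionals:
  assumes "\<And>\<phi>. cmod (cdual_apply \<phi> y) \<le> b * norm \<phi>" "0 \<le> b"
  shows "norm y \<le> b"
proof -
  obtain \<phi> where \<phi>: "norm \<phi> \<le> 1" "norm y \<le> cmod (cdual_apply \<phi> y)"
    using norming_functional by blast
  then show ?thesis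
    using assms(1)[of \<phi>] mult_left_mono[OF \<phi>(1) assms(2)] by simp
qed

lemma eq_by_functionals:
  assumes "\<And>\<phi>. cdual_apply \<phi> y = cdual_apply \<phi> z"
  shows "y = z"
  using norm_le_by_functionals[of "y - z" 0] assms by (simp add: cdual_diff)

section \<open>Bounded weak* continuity as a family of inequalities\<close>

text \<open>
  For linear maps this is continuity from the bounded weak* topology to the norm, as the next lemmas show.
\<close>

definition finitely_controlled :: "('b::complex_normed_vector cdual \<Rightarrow> 'c::real_normed_vector) \<Rightarrow> bool"
  where "finitely_controlled T \<longleftrightarrow> (\<forall>\<epsilon>>0. \<exists>F r. finite F \<and> 0 \<le> r \<and>
    (\<forall>\<phi>. norm (T \<phi>) \<le> \<epsilon> * norm \<phi> + r * (\<Sum>y\<in>F. cmod (cdual_apply \<phi> y))))"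

lemma weak_star_neighbourhood_zero:
  fixes V :: "'b::complex_normed_vector cdual set"
  assumes V: "openin weak_star_topology V" and 0: "0 \<in> V"
  shows "\<exists>F \<delta>. finite F \<and> 0 < \<delta> \<and> (\<forall>\<phi>. (\<forall>y\<in>F. cmod (cdual_apply \<phi> y) < \<delta>) \<longrightarrow> \<phi> \<in> V)"
proof -
  obtain W where W: "open W" "V = cdual_apply -` W"
    using V by (auto simp: weak_star_topology_def openin_pullback_topology)
  have "openin (product_topology (\<lambda>_. euclidean) UNIV) W"
    using W(1) by (simp add: open_fun_def)
  moreover have "(\<lambda>_. 0) \<in> W"
    using 0 W(2) by (simp add: zero_cdual.rep_eq)
  ultimately obtain X where X: "(\<lambda>_. 0) \<in> Pi\<^sub>E UNIV X" "\<And>y. open (X y)"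
    "finite {y. X y \<noteq> UNIV}" "Pi\<^sub>E UNIV X \<subseteq> W"
    using product_topology_open_contains_basis[of "\<lambda>_. euclidean" UNIV W "\<lambda>_. 0"] by auto
  have "\<exists>d>0. ball 0 d \<subseteq> X y" for y
    using X(1,2) by (auto simp: open_contains_ball PiE_def)
  then obtain d where d: "\<And>y. 0 < d y" "\<And>y. ball 0 (d y) \<subseteq> X y"
    by metis
  define F where "F = {y. X y \<noteq> UNIV}"
  define \<delta> where "\<delta> = Min (insert 1 (d ` F))"
  have \<delta>: "0 < \<delta>" "\<And>y. y \<in> F \<Longrightarrow> \<delta> \<le> d y"
    using X(3) d(1) by (auto simp: \<delta>_def F_def)
  have "\<phi> \<in> V" if "\<forall>y\<in>F. cmod (cdual_apply \<phi> y) < \<delta>" for \<phi>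
  proof -
    have "cdual_apply \<phi> y \<in> X y" for y
    proof (cases "y \<in> F")
      case True
      then have "cdual_apply \<phi> y \<in> ball 0 (d y)"
        using that \<delta>(2) by force
      then show ?thesis
        using d(2) by blast
    qed (simp add: F_def)
    then have "cdual_apply \<phi> \<in> W"
      using X(4) by auto
    then show ?thesis
      by (simp add: W(2))
  qed
  then show ?thesis
    using \<delta>(1) X(3) unfolding F_def by blast
qed

text \<open>
  On the unit ball, \<open>\<parallel>T \<phi>\<parallel> < \<epsilon>\<close> as soon as \<open>\<bar>\<phi> y\<bar> < \<delta>\<close> on a finite set \<open>F\<close>. Scaling \<open>\<phi>\<close> to satisfy both
  conditions turns this into an inequality with \<open>r = \<epsilon> / \<delta>\<close>.
\<close>

lemma bw_star_operators_finitely_controlled: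
  fixes T :: "'b::complex_normed_vector cdual \<Rightarrow> 'c::complex_normed_vector"
  assumes T: "T \<in> bw_star_operators"
  shows "finitely_controlled T"
  unfolding finitely_controlled_def
proof (intro allI impI)
  fix \<epsilon> :: real assume \<epsilon>: "0 < \<epsilon>"
  have lin: "linear T"
    using T by (simp add: bw_star_operators_def clinear_imp_linear)
  have "openin bw_star_topology (T -` ball 0 \<epsilon>)"
    using T openin_continuous_map_preimage[of bw_star_topology euclidean T "ball 0 \<epsilon>"]
    by (simp add: bw_star_operators_def vimage_def)
  then obtain V where V: "openin weak_star_topology V" "T -` ball 0 \<epsilon> \<inter> cball 0 1 = V \<inter> cball 0 1"
    unfolding openin_bw_star openin_subtopology by (meson bounded_cball)
  have "0 \<in> T -` ball 0 \<epsilon> \<inter> cball 0 1"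
    using \<epsilon> by (simp add: linear_0[OF lin])
  then have "0 \<in> V"
    unfolding V(2) by simp
  then obtain F \<delta> where F: "finite F" "0 < \<delta>"
    "\<And>\<phi>. \<forall>y\<in>F. cmod (cdual_apply \<phi> y) < \<delta> \<Longrightarrow> \<phi> \<in> V"
    using weak_star_neighbourhood_zero[OF V(1)] by blast
  have small: "norm (T \<phi>) < \<epsilon>" if "norm \<phi> \<le> 1" "\<forall>y\<in>F. cmod (cdual_apply \<phi> y) < \<delta>" for \<phi>
  proof -
    have "\<phi> \<in> V \<inter> cball 0 1"
      using F(3)[OF that(2)] that(1) by simp
    then show ?thesis
      unfolding V(2)[symmetric] by simp
  qed
  have "norm (T \<phi>) \<le> \<epsilon> * norm \<phi> + \<epsilon> / \<delta> * (\<Sum>y\<in>F. cmod (cdual_apply \<phi> y))" for \<phi>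
  proof -
    define \<Sigma> where "\<Sigma> = (\<Sum>y\<in>F. cmod (cdual_apply \<phi> y))"
    have \<Sigma>: "0 \<le> \<Sigma>" "\<And>y. y \<in> F \<Longrightarrow> cmod (cdual_apply \<phi> y) \<le> \<Sigma>"
      unfolding \<Sigma>_def using F(1)
      by (simp_all add: sum_nonneg member_le_sum[where f = "\<lambda>y. cmod (cdual_apply \<phi> y)"])
    \<comment> \<open>The right-hand side may vanish, so \<open>\<phi>\<close> is scaled by any strictly larger number.\<close>
    have "norm (T \<phi>) / \<epsilon> \<le> norm \<phi> + \<Sigma> / \<delta>"
    proof (rule dense_ge)
      fix s assume s: "norm \<phi> + \<Sigma> / \<delta> < s"
      have "\<Sigma> / \<delta> < s"
        using s norm_ge_zero[of \<phi>] by linarith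
      then have pos: "0 < s" "norm \<phi> \<le> s" "\<Sigma> < s * \<delta>"
        using s divide_nonneg_pos[OF \<Sigma>(1) F(2)]
        by (linarith, linarith, simp add: pos_divide_less_eq[OF F(2)])
      have "norm (T (inverse s *\<^sub>R \<phi>)) < \<epsilon>"
      proof (rule small)
        show "norm (inverse s *\<^sub>R \<phi>) \<le> 1"
          using pos by (simp add: field_simps)
        show "\<forall>y\<in>F. cmod (cdual_apply (inverse s *\<^sub>R \<phi>) y) < \<delta>"
        proof
          fix y assume "y \<in> F"
          then have "cmod (cdual_apply \<phi> y) < s * \<delta>"
            using \<Sigma>(2)[of y] pos(3) by linarith
          then show "cmod (cdual_apply (inverse s *\<^sub>R \<phi>) y) < \<delta>"
            using pos(1) by (simp add: scaleR_cdual.rep_eq norm_mult norm_inverse field_simps)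
        qed
      qed
      then show "norm (T \<phi>) / \<epsilon> \<le> s"
        using pos \<epsilon> by (simp add: linear_scale[OF lin] field_simps)
    qed
    then show ?thesis
      using \<epsilon> F(2) by (simp add: \<Sigma>_def field_simps)
  qed
  then show "\<exists>F r. finite F \<and> 0 \<le> r \<and>
      (\<forall>\<phi>. norm (T \<phi>) \<le> \<epsilon> * norm \<phi> + r * (\<Sum>y\<in>F. cmod (cdual_apply \<phi> y)))"
    using F(1,2) \<epsilon> by (intro exI[of _ F] exI[of _ "\<epsilon> / \<delta>"]) simp
qed

text \<open>
  On a set of radius \<open>M\<close> differences have norm at most \<open>2 M\<close>, so the \<open>\<epsilon>\<close>-term of the inequality
  is uniformly small there, and the remaining term is weak* continuous.
\<close>

lemma finitely_controlled_bw_star_operators: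
  fixes T :: "'b::complex_normed_vector cdual \<Rightarrow> 'c::complex_normed_vector"
  assumes T: "clinear T" and ctrl: "finitely_controlled T"
  shows "T \<in> bw_star_operators"
proof -
  have lin: "linear T"
    by (rule clinear_imp_linear[OF T])
  have "openin bw_star_topology (T -` U)" if U: "open U" for U
    unfolding openin_bw_star
  proof (intro allI impI)
    fix B :: "'b cdual set" assume "bounded B"
    then obtain M where M: "0 < M" "\<And>\<phi>. \<phi> \<in> B \<Longrightarrow> norm \<phi> \<le> M"
      by (auto simp: bounded_pos)
    show "openin (subtopology weak_star_topology B) (T -` U \<inter> B)"
    proof (subst openin_subopen, intro ballI)
      fix \<phi>\<^sub>0 assume \<phi>\<^sub>0: "\<phi>\<^sub>0 \<in> T -` U \<inter> B"
      then obtain e where e: "0 < e" "ball (T \<phi>\<^sub>0) e \<subseteq> U"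
        using U by (auto simp: open_contains_ball)
      have "0 < e / (4 * M)"
        using e(1) M(1) by simp
      then obtain F r where F: "finite F" "0 \<le> r"
        and le: "\<And>\<phi>. norm (T \<phi>) \<le> e / (4 * M) * norm \<phi> + r * (\<Sum>y\<in>F. cmod (cdual_apply \<phi> y))"
        using ctrl unfolding finitely_controlled_def by blast
      define W where
        "W = {g :: 'b \<Rightarrow> complex. r * (\<Sum>y\<in>F. cmod (g y - cdual_apply \<phi>\<^sub>0 y)) < e / 2}"
      have "open W"
        unfolding W_def by (intro open_Collect_less continuous_intros continuous_on_product_coordinates)
      then have W: "openin weak_star_topology (cdual_apply -` W)"
        by (auto simp: weak_star_topology_def openin_pullback_topology)
      have "cdual_apply -` W \<inter> B \<subseteq> T -` U \<inter> B"
      proof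
        fix \<phi> assume \<phi>: "\<phi> \<in> cdual_apply -` W \<inter> B"
        have "norm (\<phi> - \<phi>\<^sub>0) \<le> 2 * M"
          using M(2)[of \<phi>] M(2)[of \<phi>\<^sub>0] \<phi> \<phi>\<^sub>0 norm_triangle_ineq4[of \<phi> \<phi>\<^sub>0] by simp
        then have "e / (4 * M) * norm (\<phi> - \<phi>\<^sub>0) \<le> e / (4 * M) * (2 * M)"
          using e(1) M(1) by (intro mult_left_mono) simp_all
        also have "\<dots> = e / 2"
          using M(1) by simp
        finally have "norm (T (\<phi> - \<phi>\<^sub>0)) < e"
          using le[of "\<phi> - \<phi>\<^sub>0"] \<phi> by (simp add: W_def minus_cdual.rep_eq)
        then have "T \<phi> \<in> ball (T \<phi>\<^sub>0) e"
          by (simp add: linear_diff[OF lin] dist_norm norm_minus_commute)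
        then show "\<phi> \<in> T -` U \<inter> B"
          using e(2) \<phi> by auto
      qed
      moreover have "\<phi>\<^sub>0 \<in> cdual_apply -` W \<inter> B"
        using \<phi>\<^sub>0 e(1) by (simp add: W_def)
      moreover have "openin (subtopology weak_star_topology B) (cdual_apply -` W \<inter> B)"
        using W by (auto simp: openin_subtopology)
      ultimately show "\<exists>S. openin (subtopology weak_star_topology B) S \<and> \<phi>\<^sub>0 \<in> S \<and> S \<subseteq> T -` U \<inter> B"
        by blast
    qed
  qed
  then show ?thesis
    using T by (simp add: bw_star_operators_def continuous_map_def vimage_def)
qed

section \<open>Pre-adjoints of bounded weak* continuous operators\<close>

lemma combination_near_functional:
  fixes \<psi> :: "'y::complex_normed_vector cdual \<Rightarrow> complex"
  assumes "clinear \<psi>" "finite F" "0 \<le> r" "0 \<le> \<epsilon>"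
    and "\<And>\<phi>. cmod (\<psi> \<phi>) \<le> \<epsilon> * norm \<phi> + r * (\<Sum>y\<in>F. cmod (cdual_apply \<phi> y))"
  shows "\<exists>c. (\<forall>y\<in>F. cmod (c y) \<le> r) \<and>
    (\<forall>\<phi>. cmod (\<psi> \<phi> - cdual_apply \<phi> (\<Sum>y\<in>F. c y *\<^sub>C y)) \<le> \<epsilon> * norm \<phi>)"
proof -
  have "complex_seminorm (\<lambda>\<phi> :: 'y cdual. \<epsilon> * norm \<phi>)"
    using assms(4)
    by (auto simp: complex_seminorm_def norm_scaleC simp flip: distrib_left
        intro!: mult_left_mono norm_triangle_ineq)
  from approximate_by_combination[where \<eta> = "\<lambda>y \<phi>. cdual_apply \<phi> y", OF assms(2) _ assms(3,1) this assms(5)]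
  show ?thesis
    by (simp add: clinear_cdual_eval cdual_sum cdual_scaleC)
qed

text \<open>
  Points of \<open>Y\<close> whose evaluations approximate \<open>\<psi>\<close> in norm form a Cauchy sequence, since
  evaluation preserves the norm; the limit represents \<open>\<psi>\<close>.
\<close>

lemma finitely_controlled_functional_is_evaluation:
  fixes \<psi> :: "'y::complex_banach cdual \<Rightarrow> complex"
  assumes \<psi>: "clinear \<psi>" and ctrl: "finitely_controlled \<psi>"
  shows "\<exists>y. \<forall>\<phi>. cdual_apply \<phi> y = \<psi> \<phi>"
proof -
  have "\<exists>y. \<forall>\<phi>. cmod (\<psi> \<phi> - cdual_apply \<phi> y) \<le> inverse (Suc n) * norm \<phi>" for n
  proof -
    have pos: "0 < inverse (real (Suc n))" by simp
    then obtain F r where "finite F" "0 \<le> r"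
      "\<And>\<phi>. cmod (\<psi> \<phi>) \<le> inverse (Suc n) * norm \<phi> + r * (\<Sum>y\<in>F. cmod (cdual_apply \<phi> y))"
      using ctrl unfolding finitely_controlled_def by blast
    from combination_near_functional[OF \<psi> this(1,2) less_imp_le[OF pos] this(3)]
    show ?thesis by blast
  qed
  then obtain y where y: "\<And>n \<phi>. cmod (\<psi> \<phi> - cdual_apply \<phi> (y n)) \<le> inverse (Suc n) * norm \<phi>"
    by metis
  have dist: "norm (y m - y n) \<le> inverse (Suc m) + inverse (Suc n)" for m n
  proof (rule norm_le_by_functionals)
    fix \<phi>
    have "cmod (cdual_apply \<phi> (y m - y n))
        = cmod ((\<psi> \<phi> - cdual_apply \<phi> (y n)) - (\<psi> \<phi> - cdual_apply \<phi> (y m)))"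
      by (simp add: cdual_diff)
    also have "\<dots> \<le> cmod (\<psi> \<phi> - cdual_apply \<phi> (y n)) + cmod (\<psi> \<phi> - cdual_apply \<phi> (y m))"
      by (rule norm_triangle_ineq4)
    also have "\<dots> \<le> (inverse (Suc m) + inverse (Suc n)) * norm \<phi>"
      using y[of \<phi> m] y[of \<phi> n] by (simp add: algebra_simps)
    finally show "cmod (cdual_apply \<phi> (y m - y n)) \<le> (inverse (Suc m) + inverse (Suc n)) * norm \<phi>" .
  qed simp
  have "Cauchy y"
  proof (rule metric_CauchyI)
    fix e :: real assume "0 < e"
    then obtain N where N: "inverse (Suc N) < e / 2"
      using reals_Archimedean[of "e / 2"] by auto
    have "dist (y m) (y n) < e" if "N \<le> m" "N \<le> n" for m n
    proof -
      have "inverse (real (Suc m)) \<le> inverse (Suc N)" "inverse (real (Suc n)) \<le> inverse (Suc N)"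
        using that by (simp_all add: le_imp_inverse_le)
      then show ?thesis
        unfolding dist_norm using dist[of m n] N by linarith
    qed
    then show "\<exists>M. \<forall>m\<ge>M. \<forall>n\<ge>M. dist (y m) (y n) < e" by blast
  qed
  then obtain z where z: "y \<longlonglongrightarrow> z"
    using Cauchy_convergent by (auto simp: convergent_def)
  have "cdual_apply \<phi> z = \<psi> \<phi>" for \<phi>
  proof (rule LIMSEQ_unique)
    show "(\<lambda>n. cdual_apply \<phi> (y n)) \<longlonglongrightarrow> cdual_apply \<phi> z"
      by (rule bounded_linear.tendsto[OF bounded_linear_cdual z])
    have "(\<lambda>n. \<psi> \<phi> - cdual_apply \<phi> (y n)) \<longlonglongrightarrow> 0"
    proof (rule Lim_null_comparison)
      show "\<forall>\<^sub>F n in sequentially. norm (\<psi> \<phi> - cdual_apply \<phi> (y n)) \<le> inverse (Suc n) * norm \<phi>"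
        using y by simp
      show "(\<lambda>n. inverse (real (Suc n)) * norm \<phi>) \<longlonglongrightarrow> 0"
        by (intro tendsto_mult_left_zero LIMSEQ_inverse_real_of_nat)
    qed
    then show "(\<lambda>n. cdual_apply \<phi> (y n)) \<longlonglongrightarrow> \<psi> \<phi>"
      using tendsto_diff[OF tendsto_const[of "\<psi> \<phi>"]] by fastforce
  qed
  then show ?thesis by blast
qed

lemma bounded_linear_scaleC_left: "bounded_linear (\<lambda>c. c *\<^sub>C (x :: 'a::complex_normed_vector))"
  by (rule bounded_linear_intro[where K = "norm x"])
    (simp_all add: scaleC_add_left norm_scaleC scaleC_scaleC scaleR_conv_of_real
      flip: scaleC_of_real)

lemma compact_bounded_combinations:
  fixes F :: "'y::complex_normed_vector set"
  assumes "finite F"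
  shows "compact {\<Sum>y\<in>F. c y *\<^sub>C y | c. \<forall>y\<in>F. cmod (c y) \<le> r}"
  using assms
proof induction
  case (insert x F)
  let ?K = "\<lambda>F. {\<Sum>y\<in>F. c y *\<^sub>C y | c. \<forall>y\<in>F. cmod (c y) \<le> r}"
  have "compact ((\<lambda>c. c *\<^sub>C x) ` cball 0 r)"
    by (intro compact_continuous_image linear_continuous_on bounded_linear_scaleC_left compact_cball)
  then have *: "compact {u + v | u v. u \<in> (\<lambda>c. c *\<^sub>C x) ` cball 0 r \<and> v \<in> ?K F}"
    using insert.IH by (rule compact_sums)
  have "?K (insert x F) = {u + v | u v. u \<in> (\<lambda>c. c *\<^sub>C x) ` cball 0 r \<and> v \<in> ?K F}"
  proof (intro equalityI subsetI)
    fix z assume "z \<in> ?K (insert x F)"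
    then show "z \<in> {u + v | u v. u \<in> (\<lambda>c. c *\<^sub>C x) ` cball 0 r \<and> v \<in> ?K F}"
      using insert.hyps by fastforce
  next
    fix z assume "z \<in> {u + v | u v. u \<in> (\<lambda>c. c *\<^sub>C x) ` cball 0 r \<and> v \<in> ?K F}"
    then obtain a c where "cmod a \<le> r" "\<forall>y\<in>F. cmod (c y) \<le> r"
      and z: "z = a *\<^sub>C x + (\<Sum>y\<in>F. c y *\<^sub>C y)"
      by auto
    moreover have "(\<Sum>y\<in>F. (c(x := a)) y *\<^sub>C y) = (\<Sum>y\<in>F. c y *\<^sub>C y)"
      using insert.hyps by (intro sum.cong) auto
    ultimately show "z \<in> ?K (insert x F)"
      using insert.hyps by (intro CollectI exI[of _ "c(x := a)"]) auto
  qed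
  with * show ?case by simp
qed simp

lemma compact_closure_if_near_compact:
  fixes A :: "'y::complete_space set"
  assumes near: "\<And>\<epsilon>. 0 < \<epsilon> \<Longrightarrow> \<exists>K. compact K \<and> (\<forall>z\<in>A. \<exists>k\<in>K. dist k z \<le> \<epsilon>)"
  shows "compact (closure A)"
  unfolding compact_eq_totally_bounded
proof (intro conjI allI impI)
  show "complete (closure A)"
    by (simp add: complete_eq_closed)
  fix e :: real assume e: "0 < e"
  then obtain K where K: "compact K" "\<And>z. z \<in> A \<Longrightarrow> \<exists>k\<in>K. dist k z \<le> e / 3"
    using near[of "e / 3"] by auto
  obtain N where N: "finite N" "K \<subseteq> (\<Union>x\<in>N. ball x (e / 3))"
    using K(1) e unfolding compact_eq_totally_bounded by (meson divide_pos_pos zero_less_numeral)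
  have "A \<subseteq> (\<Union>x\<in>N. cball x (2 * e / 3))"
  proof
    fix z assume "z \<in> A"
    then obtain k where k: "k \<in> K" "dist k z \<le> e / 3"
      using K(2) by blast
    then obtain x where "x \<in> N" "dist x k < e / 3"
      using N(2) by auto
    then show "z \<in> (\<Union>x\<in>N. cball x (2 * e / 3))"
      using k(2) dist_triangle[of x z k] by (intro UN_I[of x]) auto
  qed
  then have "closure A \<subseteq> (\<Union>x\<in>N. cball x (2 * e / 3))"
    using N(1) by (intro closure_minimal closed_UN) auto
  also have "\<dots> \<subseteq> (\<Union>x\<in>N. ball x e)"
    using e by fastforce
  finally show "\<exists>N. finite N \<and> closure A \<subseteq> (\<Union>x\<in>N. ball x e)"
    using N(1) by blast
qed

text \<open>
  For \<open>\<parallel>\<mu>\<parallel> \<le> 1\<close> the functional \<open>\<mu> \<circ> T\<close> is controlled by the same \<open>F\<close> and \<open>r\<close> as \<open>T\<close>. This uniformity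
  in \<open>\<mu>\<close> gives, beyond the existence of \<open>S \<mu>\<close>, a compact set of combinations that comes within
  \<open>\<epsilon>\<close> of every \<open>S \<mu>\<close>.
\<close>

theorem compact_preadjoint:
  fixes T :: "'y::complex_banach cdual \<Rightarrow> 'w::complex_normed_vector"
  assumes T: "T \<in> bw_star_operators"
  shows "\<exists>S. clinear S \<and> bounded_linear S \<and> compact (closure (S ` cball 0 1))
    \<and> (\<forall>\<phi> \<mu>. cdual_apply \<phi> (S \<mu>) = cdual_apply \<mu> (T \<phi>))"
proof -
  have cT: "clinear T"
    using T by (simp add: bw_star_operators_def)
  have bT: "bounded_linear T"
    by (rule bw_star_operators_bounded_linear[OF T])
  have ctrl: "finitely_controlled T"
    by (rule bw_star_operators_finitely_controlled[OF T])
  have clinear_comp: "clinear (\<lambda>\<phi>. cdual_apply \<mu> (T \<phi>))" for \<mu>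
    using cT by (simp add: clinear_iff cdual_add cdual_scaleC scaleC_complex_def)
  have small_controlled: "cmod (cdual_apply \<mu> (T \<phi>)) \<le> norm (T \<phi>)" if "norm \<mu> \<le> 1" for \<mu> \<phi>
    using cdual_bound[of \<mu> "T \<phi>"] mult_right_mono[OF that norm_ge_zero[of "T \<phi>"]] by simp
  have "\<exists>y. \<forall>\<phi>. cdual_apply \<phi> y = cdual_apply \<mu> (T \<phi>)" for \<mu>
  proof (rule finitely_controlled_functional_is_evaluation[OF clinear_comp])
    show "finitely_controlled (\<lambda>\<phi>. cdual_apply \<mu> (T \<phi>))"
      unfolding finitely_controlled_def
    proof (intro allI impI)
      fix \<epsilon> :: real assume \<epsilon>: "0 < \<epsilon>"
      \<comment> \<open>Adding \<open>1\<close> allows division by \<open>k\<close> when \<open>\<mu> = 0\<close>.\<close>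
      define k where "k = norm \<mu> + 1"
      have k: "0 < k" by (simp add: k_def add_nonneg_pos)
      obtain F r where F: "finite F" "0 \<le> r"
        and le: "\<And>\<phi>. norm (T \<phi>) \<le> \<epsilon> / k * norm \<phi> + r * (\<Sum>y\<in>F. cmod (cdual_apply \<phi> y))"
        using ctrl \<epsilon> k unfolding finitely_controlled_def by (meson divide_pos_pos)
      have "cmod (cdual_apply \<mu> (T \<phi>)) \<le> \<epsilon> * norm \<phi> + (k * r) * (\<Sum>y\<in>F. cmod (cdual_apply \<phi> y))"
        for \<phi>
      proof -
        have "cmod (cdual_apply \<mu> (T \<phi>)) \<le> norm \<mu> * norm (T \<phi>)"
          by (rule cdual_bound)
        also have "\<dots> \<le> k * norm (T \<phi>)"
          by (rule mult_right_mono) (simp_all add: k_def)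
        also have "\<dots> \<le> k * (\<epsilon> / k * norm \<phi> + r * (\<Sum>y\<in>F. cmod (cdual_apply \<phi> y)))"
          using k le by (intro mult_left_mono) simp_all
        finally show ?thesis
          using k by (simp add: algebra_simps)
      qed
      then show "\<exists>F r. finite F \<and> 0 \<le> r \<and> (\<forall>\<phi>. norm (cdual_apply \<mu> (T \<phi>))
          \<le> \<epsilon> * norm \<phi> + r * (\<Sum>y\<in>F. cmod (cdual_apply \<phi> y)))"
        using F k by (intro exI[of _ F] exI[of _ "k * r"]) simp
    qed
  qed
  then obtain S where S: "\<And>\<phi> \<mu>. cdual_apply \<phi> (S \<mu>) = cdual_apply \<mu> (T \<phi>)"
    by metis
  have "clinear S"
    unfolding clinear_iff
    by (intro conjI allI; rule eq_by_functionals)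
      (simp_all add: S cdual_add cdual_scaleC plus_cdual.rep_eq scaleC_cdual.rep_eq scaleC_complex_def)
  moreover have "bounded_linear S"
  proof (rule bounded_linear_intro[where K = "onorm T"])
    fix \<mu>
    show "norm (S \<mu>) \<le> norm \<mu> * onorm T"
    proof (rule norm_le_by_functionals)
      fix \<phi>
      have "cmod (cdual_apply \<mu> (T \<phi>)) \<le> norm \<mu> * (onorm T * norm \<phi>)"
        using cdual_bound[of \<mu> "T \<phi>"] mult_left_mono[OF onorm[OF bT, of \<phi>] norm_ge_zero[of \<mu>]]
        by simp
      then show "cmod (cdual_apply \<phi> (S \<mu>)) \<le> norm \<mu> * onorm T * norm \<phi>"
        by (simp add: S mult.assoc)
    qed (simp add: onorm_pos_le[OF bT])
  qed (use clinear_imp_linear[OF \<open>clinear S\<close>] in \<open>simp_all add: linear_add linear_scale\<close>)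
  moreover have "compact (closure (S ` cball 0 1))"
  proof (rule compact_closure_if_near_compact)
    fix \<epsilon> :: real assume \<epsilon>: "0 < \<epsilon>"
    then obtain F r where F: "finite F" "0 \<le> r"
      and le: "\<And>\<phi>. norm (T \<phi>) \<le> \<epsilon> * norm \<phi> + r * (\<Sum>y\<in>F. cmod (cdual_apply \<phi> y))"
      using ctrl unfolding finitely_controlled_def by blast
    let ?K = "{\<Sum>y\<in>F. c y *\<^sub>C y | c. \<forall>y\<in>F. cmod (c y) \<le> r}"
    have "\<exists>k\<in>?K. dist k (S \<mu>) \<le> \<epsilon>" if "norm \<mu> \<le> 1" for \<mu>
    proof -
      have "\<exists>c. (\<forall>y\<in>F. cmod (c y) \<le> r) \<and> (\<forall>\<phi>. cmod (cdual_apply \<mu> (T \<phi>)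
          - cdual_apply \<phi> (\<Sum>y\<in>F. c y *\<^sub>C y)) \<le> \<epsilon> * norm \<phi>)"
        using clinear_comp F less_imp_le[OF \<epsilon>]
      proof (rule combination_near_functional)
        show "cmod (cdual_apply \<mu> (T \<phi>)) \<le> \<epsilon> * norm \<phi> + r * (\<Sum>y\<in>F. cmod (cdual_apply \<phi> y))" for \<phi>
          using small_controlled[OF that, of \<phi>] le[of \<phi>] by simp
      qed
      then obtain c where c: "\<forall>y\<in>F. cmod (c y) \<le> r"
        "\<And>\<phi>. cmod (cdual_apply \<phi> (S \<mu> - (\<Sum>y\<in>F. c y *\<^sub>C y))) \<le> \<epsilon> * norm \<phi>"
        by (auto simp: S cdual_diff)
      have "norm (S \<mu> - (\<Sum>y\<in>F. c y *\<^sub>C y)) \<le> \<epsilon>"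
        using c(2) less_imp_le[OF \<epsilon>] by (rule norm_le_by_functionals)
      then have "dist (\<Sum>y\<in>F. c y *\<^sub>C y) (S \<mu>) \<le> \<epsilon>"
        by (simp add: dist_norm norm_minus_commute)
      then show ?thesis
        using c(1) by blast
    qed
    then show "\<exists>K. compact K \<and> (\<forall>z\<in>S ` cball 0 1. \<exists>k\<in>K. dist k z \<le> \<epsilon>)"
      using compact_bounded_combinations[OF F(1), of r] by (intro exI[of _ ?K]) auto
  qed
  ultimately show ?thesis
    using S by blast
qed

section \<open>Evaluation functionals depend holomorphically on the point\<close>

lemma
  fixes f :: "('a::complex_normed_vector, 'b::complex_normed_vector) hol_lip0"
  shows hol_lip0_holomorphic: "holomorphic_map_on (ball 0 1) (hol_lip0_apply f)"
    and hol_lip0_lipschitz: "\<exists>C. C-lipschitz_on (ball 0 1) (hol_lip0_apply f)"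
    and hol_lip0_zero: "hol_lip0_apply f 0 = 0"
    and hol_lip0_outside: "x \<notin> ball 0 1 \<Longrightarrow> hol_lip0_apply f x = 0"
  using hol_lip0_apply[of f] by blast+

lemma hol_lip0_bound:
  assumes "x \<in> ball 0 1" "y \<in> ball 0 1"
  shows "norm (hol_lip0_apply f x - hol_lip0_apply f y) \<le> norm f * norm (x - y)"
  using hol_lip0_lipschitz[of f] lip_norm_bound[OF _ assms] unfolding norm_hol_lip0.rep_eq by blast

lemma norm_hol_lip0_le:
  assumes "\<And>x y. x \<in> ball 0 1 \<Longrightarrow> y \<in> ball 0 1 \<Longrightarrow>
      norm (hol_lip0_apply f x - hol_lip0_apply f y) \<le> C * norm (x - y)" "0 \<le> C"
  shows "norm f \<le> C"
  unfolding norm_hol_lip0.rep_eq by (rule lip_norm_le[OF assms])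

lemma hol_lip0_eqI:
  "(\<And>x. hol_lip0_apply f x = hol_lip0_apply g x) \<Longrightarrow> f = g"
  by (simp add: fun_eq_iff flip: hol_lip0_apply_inject)

lemma norm_cdual_le:
  "(\<And>v. cmod (cdual_apply \<phi> v) \<le> b * norm v) \<Longrightarrow> 0 \<le> b \<Longrightarrow> norm \<phi> \<le> b"
  by (simp add: norm_cdual.rep_eq onorm_bound)

text \<open>
  At points outside the ball this is the zero functional, so its composition with a linear map is again
  extended by \<open>0\<close>.
\<close>

lift_definition point_evaluation :: "'a::complex_normed_vector \<Rightarrow> ('a, complex) hol_lip0 cdual"
  is "\<lambda>x g. hol_lip0_apply g x"
proof -
  fix x :: 'a
  let ?l = "\<lambda>g :: ('a, complex) hol_lip0. hol_lip0_apply g x"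
  have l: "clinear ?l"
    by (simp add: clinear_iff plus_hol_lip0.rep_eq scaleC_hol_lip0.rep_eq)
  have "cmod (?l g) \<le> norm x * norm g" for g
    using hol_lip0_bound[of x 0 g] hol_lip0_outside[of x g]
    by (cases "x \<in> ball 0 1") (auto simp: hol_lip0_zero mult.commute)
  from cdual_exists[OF l this] show "clinear ?l \<and> bounded_linear ?l"
    using clinear_cdual bounded_linear_cdual by (metis norm_ge_zero)
qed

lemma point_evaluation_lipschitz:
  assumes "x \<in> ball 0 1" "y \<in> ball 0 1"
  shows "norm (point_evaluation x - point_evaluation y) \<le> norm (x - y)"
proof (rule norm_cdual_le)
  fix g :: "('a, complex) hol_lip0"
  show "cmod (cdual_apply (point_evaluation x - point_evaluation y) g) \<le> norm (x - y) * norm g"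
    using hol_lip0_bound[OF assms, of g]
    by (simp add: minus_cdual.rep_eq point_evaluation.rep_eq mult.commute)
qed simp

text \<open>
  The growth bound controls \<open>G\<close> on circles of radius \<open>R / 2\<close>, and Cauchy's inequality turns this into
  bounds for \<open>G'(0)\<close> and, if \<open>R \<ge> 4\<close>, for the second derivative on the unit disc. Integrating the latter
  gives the remainder of order \<open>1 / R\<close>.
\<close>

lemma Taylor_estimate_on_ball:
  assumes G: "G holomorphic_on ball 0 R" and R: "0 < R"
    and le: "\<And>z. z \<in> ball 0 R \<Longrightarrow> cmod (G z) \<le> K * cmod z"
  shows "cmod (deriv G 0) \<le> K"
    and "4 \<le> R \<Longrightarrow> cmod (G 1 - deriv G 0) \<le> 8 * K / R"
proof -
  have K: "0 \<le> K"
  proof -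
    have "0 \<le> K * cmod (of_real (R / 2))"
      using R by (intro order_trans[OF norm_ge_zero le]) simp
    then show ?thesis
      using R by (simp add: zero_le_mult_iff)
  qed
  have higher: "cmod ((deriv ^^ n) G z) \<le> fact n * B / (R / 2) ^ n"
    if z: "cmod z < R / 2" and B: "\<And>w. cmod (z - w) = R / 2 \<Longrightarrow> cmod (G w) \<le> B" for n z B
  proof (rule Cauchy_inequality)
    have sub: "cball z (R / 2) \<subseteq> ball 0 R"
    proof
      fix w assume "w \<in> cball z (R / 2)"
      then show "w \<in> ball 0 R"
        using z norm_triangle_ineq2[of w z] by (simp add: dist_norm norm_minus_commute)
    qed
    show "G holomorphic_on ball z (R / 2)"
      using sub ball_subset_cball by (blast intro: holomorphic_on_subset[OF G])
    show "continuous_on (cball z (R / 2)) G"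
      using holomorphic_on_imp_continuous_on[OF G] sub by (rule continuous_on_subset)
  qed (use R B in auto)
  have "cmod ((deriv ^^ 1) G 0) \<le> fact 1 * (K * (R / 2)) / (R / 2) ^ 1"
  proof (rule higher)
    fix w :: complex assume "cmod (0 - w) = R / 2"
    then have w: "cmod w = R / 2" by simp
    then have "w \<in> ball 0 R"
      using R by simp
    from le[OF this] show "cmod (G w) \<le> K * (R / 2)"
      unfolding w .
  qed (use R in simp)
  then show "cmod (deriv G 0) \<le> K"
    using R by simp
  assume R4: "4 \<le> R"
  have second: "cmod ((deriv ^^ 2) G z) \<le> 8 * K / R" if "cmod z \<le> 1" for z
  proof -
    have "cmod ((deriv ^^ 2) G z) \<le> fact 2 * (K * R) / (R / 2) ^ 2"
    proof (rule higher)
      fix w assume "cmod (z - w) = R / 2"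
      then have "cmod w < R"
        using that R4 norm_triangle_ineq2[of w z] by (simp add: norm_minus_commute)
      then show "cmod (G w) \<le> K * R"
        using le[of w] mult_left_mono[OF _ K, of "cmod w" R] by simp
    qed (use that R4 in simp)
    also have "\<dots> = 8 * K / R"
      using R by (simp add: power2_eq_square field_simps)
    finally show ?thesis .
  qed
  have "cmod ((deriv ^^ 0) G 1 - (\<Sum>i\<le>1. (deriv ^^ i) G 0 * (1 - 0) ^ i / fact i))
      \<le> 8 * K / R * cmod (1 - 0) ^ Suc 1 / fact 1"
  proof (rule complex_Taylor[where S = "cball 0 1"])
    fix i z assume z: "z \<in> cball (0 :: complex) 1"
    have "(deriv ^^ i) G holomorphic_on ball 0 R"
      by (rule holomorphic_higher_deriv[OF G]) simp
    moreover have "z \<in> ball 0 R"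
      using z R4 by simp
    ultimately have "((deriv ^^ i) G has_field_derivative deriv ((deriv ^^ i) G) z) (at z)"
      by (intro holomorphic_derivI[of _ "ball 0 R"]) auto
    then show "((deriv ^^ i) G has_field_derivative (deriv ^^ Suc i) G z) (at z within cball 0 1)"
      by (simp add: has_field_derivative_at_within)
  qed (use second in \<open>simp_all add: numeral_2_eq_2\<close>)
  moreover have "G 0 = 0"
    using le[of 0] R by simp
  ultimately show "cmod (G 1 - deriv G 0) \<le> 8 * K / R"
    by simp
qed

lemma hol_lip0_frechet:
  assumes "x \<in> ball 0 1"
  shows "(hol_lip0_apply g has_derivative frechet_derivative (hol_lip0_apply g) (at x)) (at x)"
    and "clinear (frechet_derivative (hol_lip0_apply g) (at x))"
proof -
  obtain D where "clinear D" "(hol_lip0_apply g has_derivative D) (at x)"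
    using hol_lip0_holomorphic[of g] assms unfolding holomorphic_map_on_def by blast
  then show "(hol_lip0_apply g has_derivative frechet_derivative (hol_lip0_apply g) (at x)) (at x)"
    and "clinear (frechet_derivative (hol_lip0_apply g) (at x))"
    using frechet_derivative_at by auto
qed

lemma frechet_derivative_add_scaleC:
  fixes f g :: "('a::complex_normed_vector, complex) hol_lip0"
  assumes "x \<in> ball 0 1"
  shows "frechet_derivative (hol_lip0_apply (f + g)) (at x) h
      = frechet_derivative (hol_lip0_apply f) (at x) h + frechet_derivative (hol_lip0_apply g) (at x) h"
    and "frechet_derivative (hol_lip0_apply (c *\<^sub>C f)) (at x) h
      = c *\<^sub>C frechet_derivative (hol_lip0_apply f) (at x) h"
proof -
  have "(hol_lip0_apply (f + g) has_derivative (\<lambda>h. frechet_derivative (hol_lip0_apply f) (at x) h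
      + frechet_derivative (hol_lip0_apply g) (at x) h)) (at x)"
    unfolding plus_hol_lip0.rep_eq using hol_lip0_frechet(1)[OF assms] by (intro has_derivative_add)
  from frechet_derivative_at[OF this] show "frechet_derivative (hol_lip0_apply (f + g)) (at x) h
      = frechet_derivative (hol_lip0_apply f) (at x) h + frechet_derivative (hol_lip0_apply g) (at x) h"
    by metis
  have "(hol_lip0_apply (c *\<^sub>C f) has_derivative
      (\<lambda>h. c *\<^sub>C frechet_derivative (hol_lip0_apply f) (at x) h)) (at x)"
    unfolding scaleC_hol_lip0.rep_eq
    by (rule bounded_linear.has_derivative[OF bounded_linear_scaleC_right hol_lip0_frechet(1)[OF assms]])
  from frechet_derivative_at[OF this] show "frechet_derivative (hol_lip0_apply (c *\<^sub>C f)) (at x) h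
      = c *\<^sub>C frechet_derivative (hol_lip0_apply f) (at x) h"
    by metis
qed

text \<open>
  Restricting \<open>g\<close> to the complex line through \<open>x\<close> in direction \<open>h\<close> gives a function of one variable on the
  disc of radius \<open>R = (1 - \<parallel>x\<parallel>) / \<parallel>h\<parallel>\<close> that grows with rate \<open>\<parallel>g\<parallel> \<parallel>h\<parallel>\<close>. The remainder is thus quadratic in \<open>h\<close>,
  with a constant that depends on \<open>g\<close> only through its norm.
\<close>

lemma hol_lip0_Taylor:
  fixes g :: "('a::complex_normed_vector, complex) hol_lip0"
  assumes x: "x \<in> ball 0 1"
  defines "D \<equiv> frechet_derivative (hol_lip0_apply g) (at x)"
  shows "cmod (D h) \<le> norm h * norm g"
    and "4 * norm h \<le> 1 - norm x \<Longrightarrow>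
      cmod (hol_lip0_apply g (x + h) - hol_lip0_apply g x - D h)
        \<le> 8 * norm h ^ 2 / (1 - norm x) * norm g"
proof -
  have D: "clinear D"
    unfolding D_def by (rule hol_lip0_frechet(2)[OF x])
  have "cmod (D h) \<le> norm h * norm g \<and> (4 * norm h \<le> 1 - norm x \<longrightarrow>
      cmod (hol_lip0_apply g (x + h) - hol_lip0_apply g x - D h)
        \<le> 8 * norm h ^ 2 / (1 - norm x) * norm g)"
  proof (cases "h = 0")
    case True
    then show ?thesis
      using linear_0[OF clinear_imp_linear[OF D]] by simp
  next
    case False
    define R where "R = (1 - norm x) / norm h"
    have R: "0 < R"
      using x False by (simp add: R_def)
    define G where "G z = hol_lip0_apply g (x + z *\<^sub>C h) - hol_lip0_apply g x" for z
    have inball: "x + z *\<^sub>C h \<in> ball 0 1" if "z \<in> ball 0 R" for z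
    proof -
      have "cmod z * norm h < 1 - norm x"
        using that False by (simp add: R_def field_simps)
      then show ?thesis
        using norm_triangle_ineq[of x "z *\<^sub>C h"] by (simp add: norm_scaleC)
    qed
    have deriv: "(G has_field_derivative frechet_derivative (hol_lip0_apply g) (at (x + z *\<^sub>C h)) h) (at z)"
      if z: "z \<in> ball 0 R" for z
    proof -
      let ?E = "frechet_derivative (hol_lip0_apply g) (at (x + z *\<^sub>C h))"
      have "((\<lambda>z. x + z *\<^sub>C h) has_derivative (\<lambda>w. w *\<^sub>C h)) (at z)"
        using has_derivative_add[OF has_derivative_const
            bounded_linear_imp_has_derivative[OF bounded_linear_scaleC_left]] by simp
      from has_derivative_compose[OF this hol_lip0_frechet(1)[OF inball[OF z]]]
      have "(G has_derivative (\<lambda>w. ?E (w *\<^sub>C h) - 0)) (at z)"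
        unfolding G_def by (intro has_derivative_diff has_derivative_const)
      moreover have "(\<lambda>w. ?E (w *\<^sub>C h) - 0) = (*) (?E h)"
        using hol_lip0_frechet(2)[OF inball[OF z], of g]
        by (simp add: clinear_iff scaleC_complex_def fun_eq_iff mult.commute)
      ultimately show ?thesis
        by (simp add: has_field_derivative_def)
    qed
    have holo: "G holomorphic_on ball 0 R"
      unfolding holomorphic_on_open[OF open_ball] using deriv by blast
    have le: "cmod (G z) \<le> norm g * norm h * cmod z" if "z \<in> ball 0 R" for z
      using hol_lip0_bound[OF inball[OF that] x, of g] by (simp add: G_def norm_scaleC mult_ac)
    have D0: "deriv G 0 = D h"
      using DERIV_imp_deriv[OF deriv, of 0] R by (simp add: D_def)
    have "cmod (D h) \<le> norm h * norm g"
      using Taylor_estimate_on_ball(1)[OF holo R le] by (simp add: D0 mult.commute)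
    moreover have "cmod (hol_lip0_apply g (x + h) - hol_lip0_apply g x - D h)
        \<le> 8 * norm h ^ 2 / (1 - norm x) * norm g" if "4 * norm h \<le> 1 - norm x"
    proof -
      have "4 \<le> R"
        using that False by (simp add: R_def field_simps)
      from Taylor_estimate_on_ball(2)[OF holo R le this] show ?thesis
        unfolding D0 by (simp add: G_def R_def power2_eq_square mult_ac)
    qed
    ultimately show ?thesis by blast
  qed
  then show "cmod (D h) \<le> norm h * norm g"
    and "4 * norm h \<le> 1 - norm x \<Longrightarrow>
      cmod (hol_lip0_apply g (x + h) - hol_lip0_apply g x - D h)
        \<le> 8 * norm h ^ 2 / (1 - norm x) * norm g"
    by blast+
qed

text \<open>
  The derivative at \<open>x\<close> in direction \<open>h\<close> is the functional that sends \<open>g\<close> to its own derivative there.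
  Differentiability in the norm of the dual space is differentiability of all \<open>g\<close> uniformly on the unit
  ball, which the preceding Taylor estimate provides.
\<close>

lemma holomorphic_point_evaluation:
  "holomorphic_map_on (ball 0 1)
    (point_evaluation :: 'a::complex_normed_vector \<Rightarrow> ('a, complex) hol_lip0 cdual)"
  unfolding holomorphic_map_on_def
proof
  fix x :: 'a assume x: "x \<in> ball 0 1"
  let ?D = "\<lambda>g :: ('a, complex) hol_lip0. frechet_derivative (hol_lip0_apply g) (at x)"
  have "\<exists>\<phi>. cdual_apply \<phi> = (\<lambda>g. ?D g h) \<and> norm \<phi> \<le> norm h" for h
    using hol_lip0_Taylor(1)[OF x, of _ h]
    by (intro cdual_exists) (simp_all add: clinear_iff frechet_derivative_add_scaleC[OF x])
  then obtain E where E: "\<And>h. cdual_apply (E h) = (\<lambda>g. ?D g h)" "\<And>h. norm (E h) \<le> norm h"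
    by metis
  have cE: "clinear E"
    using hol_lip0_frechet(2)[OF x, where 'b = complex] unfolding clinear_iff
    by (auto simp: fun_eq_iff plus_cdual.rep_eq scaleC_cdual.rep_eq E(1)
        simp flip: cdual_apply_inject)
  have "(point_evaluation has_derivative E) (at x)"
    unfolding has_derivative_at_alt
  proof (intro conjI allI impI)
    show "bounded_linear E"
      using clinear_imp_linear[OF cE] E(2)
      by (intro bounded_linear_intro[where K = 1]) (auto simp: linear_add linear_scale)
    fix e :: real assume e: "0 < e"
    define r where "r = 1 - norm x"
    have r: "0 < r"
      using x by (simp add: r_def)
    have "norm (point_evaluation y - point_evaluation x - E (y - x)) \<le> e * norm (y - x)"
      if y: "norm (y - x) < min (r / 4) (e * r / 8)" for y
    proof (rule norm_cdual_le)
      fix g :: "('a, complex) hol_lip0"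
      have "cmod (hol_lip0_apply g (x + (y - x)) - hol_lip0_apply g x - ?D g (y - x))
          \<le> 8 * norm (y - x) ^ 2 / (1 - norm x) * norm g"
        using y by (intro hol_lip0_Taylor(2)[OF x]) (simp add: r_def)
      also have "\<dots> = 8 * norm (y - x) / r * norm (y - x) * norm g"
        by (simp add: r_def power2_eq_square)
      also have "\<dots> \<le> e * norm (y - x) * norm g"
        using y r by (intro mult_right_mono) (simp_all add: field_simps)
      finally show "cmod (cdual_apply (point_evaluation y - point_evaluation x - E (y - x)) g)
          \<le> e * norm (y - x) * norm g"
        by (simp add: minus_cdual.rep_eq point_evaluation.rep_eq E(1))
    qed (use e in simp)
    then show "\<exists>d>0. \<forall>y. norm (y - x) < d \<longrightarrow>
        norm (point_evaluation y - point_evaluation x - E (y - x)) \<le> e * norm (y - x)"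
      using e r by (intro exI[of _ "min (r / 4) (e * r / 8)"]) simp
  qed
  with cE show "\<exists>D. clinear D \<and>
      ((point_evaluation :: 'a \<Rightarrow> ('a, complex) hol_lip0 cdual) has_derivative D) (at x)"
    by blast
qed

section \<open>The transpose of a compact map\<close>

lemma transpose_apply: "hol_lip0_apply (hol_transpose f \<phi>) x = cdual_apply \<phi> (hol_lip0_apply f x)"
  by (simp add: hol_transpose.rep_eq)

lemma clinear_transpose: "clinear (hol_transpose f)"
  unfolding clinear_iff
  by (intro conjI allI; rule hol_lip0_eqI)
    (simp_all add: transpose_apply plus_hol_lip0.rep_eq scaleC_hol_lip0.rep_eq plus_cdual.rep_eq
      scaleC_cdual.rep_eq)

lemma transpose_add: "hol_transpose (f + g) \<phi> = hol_transpose f \<phi> + hol_transpose g \<phi>"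
  by (rule hol_lip0_eqI) (simp add: transpose_apply plus_hol_lip0.rep_eq cdual_add)

lemma transpose_scaleC: "hol_transpose (c *\<^sub>C f) \<phi> = c *\<^sub>C hol_transpose f \<phi>"
  by (rule hol_lip0_eqI)
    (simp add: transpose_apply scaleC_hol_lip0.rep_eq cdual_scaleC scaleC_complex_def)

lemma inj_transpose: "inj hol_transpose"
proof (rule injI)
  fix f g :: "('a, 'b) hol_lip0"
  assume eq: "hol_transpose f = hol_transpose g"
  show "f = g"
  proof (rule hol_lip0_eqI, rule eq_by_functionals)
    fix x and \<phi> :: "'b cdual"
    show "cdual_apply \<phi> (hol_lip0_apply f x) = cdual_apply \<phi> (hol_lip0_apply g x)"
      unfolding transpose_apply[symmetric] eq ..
  qed
qed

lemma norm_transpose_le: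
  fixes f :: "('a::complex_normed_vector, 'b::complex_normed_vector) hol_lip0"
  shows "norm (hol_transpose f \<phi>) \<le> norm f * norm \<phi>"
proof (rule norm_hol_lip0_le)
  fix x y :: 'a assume xy: "x \<in> ball 0 1" "y \<in> ball 0 1"
  have "cmod (cdual_apply \<phi> (hol_lip0_apply f x - hol_lip0_apply f y))
      \<le> norm \<phi> * norm (hol_lip0_apply f x - hol_lip0_apply f y)"
    by (rule cdual_bound)
  also have "\<dots> \<le> norm \<phi> * (norm f * norm (x - y))"
    by (intro mult_left_mono hol_lip0_bound xy) simp
  finally show "norm (hol_lip0_apply (hol_transpose f \<phi>) x - hol_lip0_apply (hol_transpose f \<phi>) y)
      \<le> norm f * norm \<phi> * norm (x - y)"
    by (simp add: transpose_apply cdual_diff mult_ac)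
qed simp

lemma onorm_transpose:
  fixes f :: "('a::complex_normed_vector, 'b::complex_normed_vector) hol_lip0"
  shows "onorm (hol_transpose f) = norm f"
proof (rule antisym)
  show "onorm (hol_transpose f) \<le> norm f"
    by (rule onorm_bound) (simp_all add: norm_transpose_le)
  have bl: "bounded_linear (hol_transpose f)"
    using clinear_imp_linear[OF clinear_transpose[of f]] norm_transpose_le[of f]
    by (intro bounded_linear_intro[where K = "norm f"])
      (simp_all add: linear_add linear_scale mult.commute)
  show "norm f \<le> onorm (hol_transpose f)"
  proof (rule norm_hol_lip0_le)
    fix x y :: 'a assume xy: "x \<in> ball 0 1" "y \<in> ball 0 1"
    show "norm (hol_lip0_apply f x - hol_lip0_apply f y) \<le> onorm (hol_transpose f) * norm (x - y)"
    proof (rule norm_le_by_functionals)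
      fix \<phi>
      have "cmod (cdual_apply \<phi> (hol_lip0_apply f x - hol_lip0_apply f y))
          \<le> norm (hol_transpose f \<phi>) * norm (x - y)"
        using hol_lip0_bound[OF xy, of "hol_transpose f \<phi>"] by (simp add: transpose_apply cdual_diff)
      also have "\<dots> \<le> onorm (hol_transpose f) * norm \<phi> * norm (x - y)"
        by (intro mult_right_mono onorm[OF bl]) simp
      finally show "cmod (cdual_apply \<phi> (hol_lip0_apply f x - hol_lip0_apply f y))
          \<le> onorm (hol_transpose f) * norm (x - y) * norm \<phi>"
        by (simp add: mult_ac)
    qed (simp add: onorm_pos_le[OF bl])
  qed (simp add: onorm_pos_le[OF bl])
qed

text \<open>
  A difference quotient of \<open>\<phi> \<circ> f\<close> is the value of \<open>\<phi>\<close> at a difference quotient of \<open>f\<close>, and the latter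
  lies within \<open>\<epsilon>\<close> of one of the points of a fixed finite net.
\<close>

lemma transpose_compact:
  fixes f :: "('a::complex_normed_vector, 'b::complex_normed_vector) hol_lip0"
  assumes f: "f \<in> compact_hol_lip0"
  shows "hol_transpose f \<in> bw_star_operators"
proof (rule finitely_controlled_bw_star_operators[OF clinear_transpose])
  show "finitely_controlled (hol_transpose f)"
    unfolding finitely_controlled_def
  proof (intro allI impI)
    fix \<epsilon> :: real assume \<epsilon>: "0 < \<epsilon>"
    obtain N where N: "finite N" "closure (Im_L f) \<subseteq> (\<Union>k\<in>N. ball k \<epsilon>)"
      using f \<epsilon> unfolding compact_hol_lip0_def compact_eq_totally_bounded by blast
    have "norm (hol_transpose f \<phi>) \<le> \<epsilon> * norm \<phi> + 1 * (\<Sum>y\<in>N. cmod (cdual_apply \<phi> y))" for \<phi>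
    proof (rule norm_hol_lip0_le)
      let ?C = "\<epsilon> * norm \<phi> + 1 * (\<Sum>y\<in>N. cmod (cdual_apply \<phi> y))"
      fix x y :: 'a assume xy: "x \<in> ball 0 1" "y \<in> ball 0 1"
      show "norm (hol_lip0_apply (hol_transpose f \<phi>) x - hol_lip0_apply (hol_transpose f \<phi>) y)
          \<le> ?C * norm (x - y)"
      proof (cases "x = y")
        case False
        define z where "z = (hol_lip0_apply f x - hol_lip0_apply f y) /\<^sub>R norm (x - y)"
        have "z \<in> Im_L f"
          using xy False by (auto simp: Im_L_def z_def)
        then obtain k where k: "k \<in> N" "dist k z < \<epsilon>"
          using N(2) closure_subset[of "Im_L f"] by auto
        have "cmod (cdual_apply \<phi> z) \<le> cmod (cdual_apply \<phi> (z - k)) + cmod (cdual_apply \<phi> k)"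
          using norm_triangle_ineq[of "cdual_apply \<phi> (z - k)" "cdual_apply \<phi> k"]
          by (simp add: cdual_diff)
        also have "cmod (cdual_apply \<phi> (z - k)) \<le> norm \<phi> * norm (z - k)"
          by (rule cdual_bound)
        also have "\<dots> \<le> norm \<phi> * \<epsilon>"
          using k(2) by (intro mult_left_mono) (simp_all add: dist_norm norm_minus_commute)
        also have "cmod (cdual_apply \<phi> k) \<le> (\<Sum>y\<in>N. cmod (cdual_apply \<phi> y))"
          using member_le_sum[OF k(1), of "\<lambda>y. cmod (cdual_apply \<phi> y)"] N(1) by simp
        finally have "cmod (cdual_apply \<phi> z) * norm (x - y) \<le> ?C * norm (x - y)"
          by (intro mult_right_mono) (simp_all add: mult.commute)
        moreover have "hol_lip0_apply f x - hol_lip0_apply f y = norm (x - y) *\<^sub>R z"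
          using False by (simp add: z_def)
        ultimately show ?thesis
          by (simp add: transpose_apply cdual_scaleR mult.commute flip: cdual_diff)
      qed simp
    qed (use \<epsilon> in \<open>simp add: sum_nonneg\<close>)
    then show "\<exists>F r. finite F \<and> 0 \<le> r \<and> (\<forall>\<phi>. norm (hol_transpose f \<phi>)
        \<le> \<epsilon> * norm \<phi> + r * (\<Sum>y\<in>F. cmod (cdual_apply \<phi> y)))"
      using N(1) by (intro exI[of _ N] exI[of _ 1]) simp
  qed
qed

text \<open>
  The map is the composition of the pre-adjoint of \<open>T\<close> with point evaluation. It inherits holomorphy from
  the evaluation map and compactness from the pre-adjoint.
\<close>

lemma bw_star_operator_is_transpose:
  fixes T :: "'y::complex_banach cdual \<Rightarrow> ('x::complex_normed_vector, complex) hol_lip0"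
  assumes T: "T \<in> bw_star_operators"
  shows "\<exists>f\<in>compact_hol_lip0. hol_transpose f = T"
proof -
  obtain S where S: "clinear S" "bounded_linear S" "compact (closure (S ` cball 0 1))"
    "\<And>\<phi> \<mu>. cdual_apply \<phi> (S \<mu>) = cdual_apply \<mu> (T \<phi>)"
    using compact_preadjoint[OF T] by blast
  have lin: "linear S"
    by (rule clinear_imp_linear[OF S(1)])
  define f where "f x = S (point_evaluation x)" for x
  have null: "f x = 0" if "x = 0 \<or> x \<notin> ball 0 1" for x
  proof -
    have "point_evaluation x = 0"
      using that hol_lip0_zero hol_lip0_outside
      by (auto simp: fun_eq_iff zero_cdual.rep_eq point_evaluation.rep_eq
          simp flip: cdual_apply_inject)
    then show ?thesis
      by (simp add: f_def linear_0[OF lin])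
  qed
  have "holomorphic_map_on (ball 0 1) f"
    unfolding f_def
    by (rule holomorphic_map_on_compose_clinear[OF holomorphic_point_evaluation S(1,2)])
  moreover have "\<exists>C. C-lipschitz_on (ball 0 1) f"
    unfolding f_def
  proof (rule lipschitz_on_compose_bounded_linear[OF _ S(2)])
    show "\<exists>C. C-lipschitz_on (ball 0 1) point_evaluation"
      by (intro exI[of _ 1] lipschitz_onI) (simp_all add: dist_norm point_evaluation_lipschitz)
  qed
  ultimately have f: "hol_lip0_apply (Abs_hol_lip0 f) = f"
    using null by (intro Abs_hol_lip0_inverse) simp
  have "Im_L (Abs_hol_lip0 f) \<subseteq> S ` cball 0 1"
  proof
    fix z assume "z \<in> Im_L (Abs_hol_lip0 f)"
    then obtain x y where xy: "x \<in> ball 0 1" "y \<in> ball 0 1" "x \<noteq> y"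
      and z: "z = (f x - f y) /\<^sub>R norm (x - y)"
      by (auto simp: Im_L_def f)
    have "z = S ((point_evaluation x - point_evaluation y) /\<^sub>R norm (x - y))"
      by (simp add: z f_def linear_diff[OF lin] linear_scale[OF lin])
    moreover have "norm ((point_evaluation x - point_evaluation y) /\<^sub>R norm (x - y)) \<le> 1"
      unfolding norm_scaleR using point_evaluation_lipschitz[OF xy(1,2)] xy(3)
      by (simp add: divide_simps)
    ultimately show "z \<in> S ` cball 0 1"
      by auto
  qed
  then have "Abs_hol_lip0 f \<in> compact_hol_lip0"
    using compact_Int_closed[OF S(3) closed_closure] closure_mono
    by (metis (mono_tags, lifting) Int_absorb1 compact_hol_lip0_def mem_Collect_eq)
  moreover have "hol_transpose (Abs_hol_lip0 f) = T"
    by (intro ext hol_lip0_eqI) (simp add: transpose_apply f f_def S(4) point_evaluation.rep_eq)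
  ultimately show ?thesis by blast
qed

theorem proposition2p9:
  shows "bij_betw hol_transpose
      (compact_hol_lip0 :: ('x::complex_banach, 'y::complex_banach) hol_lip0 set)
      (bw_star_operators :: ('y cdual \<Rightarrow> ('x, complex) hol_lip0) set)
    \<and> (\<forall>f\<in>compact_hol_lip0. \<forall>g\<in>compact_hol_lip0.
        hol_transpose (f + g :: ('x, 'y) hol_lip0)
          = (\<lambda>\<phi>. hol_transpose f \<phi> + hol_transpose g \<phi>))
    \<and> (\<forall>c. \<forall>f\<in>compact_hol_lip0.
        hol_transpose (c *\<^sub>C f :: ('x, 'y) hol_lip0) = (\<lambda>\<phi>. c *\<^sub>C hol_transpose f \<phi>))
    \<and> (\<forall>f\<in>compact_hol_lip0. onorm (hol_transpose (f :: ('x, 'y) hol_lip0)) = norm f)"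
proof -
  have "inj_on hol_transpose (compact_hol_lip0 :: ('x, 'y) hol_lip0 set)"
    by (rule inj_on_subset[OF inj_transpose subset_UNIV])
  moreover have "hol_transpose ` (compact_hol_lip0 :: ('x, 'y) hol_lip0 set) = bw_star_operators"
    using transpose_compact bw_star_operator_is_transpose by blast
  ultimately show ?thesis
    by (simp add: bij_betw_def transpose_add transpose_scaleC onorm_transpose fun_eq_iff)
qed

end
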